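(* Let $m\ge 2$, $n\ge 3$, and let $\Omega$ be a parallel (i.e. constant-coefficient) $(m+1)$-form on $\mathbb{R}^{m+n}=\mathbb{R}^{m+1}\oplus\mathbb{R}^{n-1}$. Let $\mathbb{S}^m$ be the unit sphere of $\mathbb{R}^{m+1}$, let $W_2,\ldots,W_n$ be a fixed orthonormal basis of the orthogonal complement $\mathbb{R}^{n-1}$ of $\mathbb{R}^{m+1}$, and for $\alpha<\beta$ let $\xi_{\alpha\beta}$ be the 1-form on $\mathbb{S}^m$ given by $\xi_{\alpha\beta}(X)=\Omega(W_\alpha,W_\beta,*X)$, $X\in T\mathbb{S}^m$. Then for every integer $l\ge 0$, every $\alpha<\beta$ and every $f\in E_{\lambda_l}$, the function $h=\xi_{\alpha\beta}(\nabla f)$ is also in $E_{\lambda_l}$, and it is $L^2(\mathbb{S}^m)$-orthogonal to $f$.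
   Context: $\nabla f$ is the gradient of $f$ on the round unit sphere $\mathbb{S}^m$. The star operator $*:T\mathbb{S}^m\to\wedge^{m-1}T\mathbb{S}^m$ is defined, for a local direct (positively oriented) orthonormal frame $e_1,\ldots,e_m$, by $*e_i=(-1)^{i-1}e_1\wedge\cdots\wedge\hat e_i\wedge\cdots\wedge e_m$, and forms are evaluated on decomposable multivectors in the usual way. $\lambda_l=l(l+m-1)$, $l=0,1,2,\ldots$, are the eigenvalues of the Laplacian on $\mathbb{S}^m$ (eigenvalue equation $\Delta f+\lambda_l f=0$ with $\Delta=\mathrm{div}\,\nabla$), and $E_{\lambda_l}$ is the corresponding (finite-dimensional) eigenspace, i.e. the restrictions to $\mathbb{S}^m$ of harmonic homogeneous polynomials of degree $l$ on $\mathbb{R}^{m+1}$. *)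

theory Defs
  imports "HOL-Analysis.Analysis"
begin

section \<open>Calculus on the unit sphere\<close>

text \<open>
  A function on the sphere is a total function on the ambient space of which only the values on
  \<^term>\<open>sphere 0 1\<close> matter: every notion below that takes a function (or a tangent vector field) on the
  sphere depends on its restriction to the sphere only.
\<close>

definition tangent_space :: "'a::euclidean_space \<Rightarrow> 'a set"
  where "tangent_space p = {X. X \<bullet> p = 0}"

definition tangent_proj :: "'a::euclidean_space \<Rightarrow> 'a \<Rightarrow> 'a"
  where "tangent_proj p x = x - (x \<bullet> p) *\<^sub>R p"

primrec Ck_on :: "nat \<Rightarrow> 'a::euclidean_space set \<Rightarrow> ('a \<Rightarrow> 'b::real_normed_vector) \<Rightarrow> bool"
  where
    "Ck_on 0 U = (\<lambda>F. continuous_on U F)"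
  | "Ck_on (Suc k) U =
       (\<lambda>F. F differentiable_on U \<and> (\<forall>v. Ck_on k U (\<lambda>x. frechet_derivative F (at x) v)))"

definition smooth_on_sphere :: "('a::euclidean_space \<Rightarrow> real) \<Rightarrow> bool"
  where "smooth_on_sphere f \<longleftrightarrow>
    (\<exists>U F. open U \<and> sphere 0 1 \<subseteq> U \<and> (\<forall>k. Ck_on k U F) \<and> (\<forall>p\<in>sphere 0 1. F p = f p))"

text \<open>
  The derivative within the sphere is determined on tangent vectors only, so the gradient is pinned
  down by requiring it to be tangent.
\<close>

definition sphere_grad :: "('a::euclidean_space \<Rightarrow> real) \<Rightarrow> 'a \<Rightarrow> 'a"
  where "sphere_grad f p =
    (THE g. g \<in> tangent_space p \<and> (f has_derivative (\<lambda>X. g \<bullet> X)) (at p within sphere 0 1))"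

text \<open>
  Levi-Civita connection of the induced metric: the tangential part of the ambient derivative of
  the vector field \<^term>\<open>V\<close> at \<^term>\<open>p\<close> in the tangent direction \<^term>\<open>X\<close>.
\<close>

definition sphere_cov_deriv :: "('a::euclidean_space \<Rightarrow> 'a) \<Rightarrow> 'a \<Rightarrow> 'a \<Rightarrow> 'a"
  where "sphere_cov_deriv V p X =
    tangent_proj p (frechet_derivative V (at p within sphere 0 1) X)"

text \<open>
  The trace of the covariant derivative of \<^term>\<open>V\<close> on the tangent space at \<^term>\<open>p\<close>. It is computed as an
  ambient trace: the endomorphism is precomposed with the projection, hence it vanishes on the
  normal line and maps into the tangent space.
\<close>

definition sphere_div :: "('a::euclidean_space \<Rightarrow> 'a) \<Rightarrow> 'a \<Rightarrow> real"
  where "sphere_div V p = (\<Sum>b\<in>Basis. sphere_cov_deriv V p (tangent_proj p b) \<bullet> b)"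

definition sphere_laplacian :: "('a::euclidean_space \<Rightarrow> real) \<Rightarrow> 'a \<Rightarrow> real"
  where "sphere_laplacian f = sphere_div (sphere_grad f)"

definition sphere_eigenspace :: "real \<Rightarrow> ('a::euclidean_space \<Rightarrow> real) set"
  where "sphere_eigenspace \<mu> =
    {f. smooth_on_sphere f \<and> (\<forall>p\<in>sphere 0 1. sphere_laplacian f p + \<mu> * f p = 0)}"

definition sphere_eigenvalue :: "nat \<Rightarrow> nat \<Rightarrow> real"
  where "sphere_eigenvalue m l = real l * (real l + real m - 1)"

text \<open>
  Surface measure of the sphere in polar coordinates: the measure of a set \<open>A\<close> is the dimension of
  the ambient space times the Lebesgue measure of the cone of all \<open>t x\<close> with \<open>x\<close> in \<open>A\<close> and
  \<open>0 < t < 1\<close>.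
\<close>

definition sphere_measure :: "'a::euclidean_space measure"
  where "sphere_measure =
    scale_measure (ennreal (real DIM('a)))
      (distr (restrict_space lborel (ball 0 1 - {0})) (restrict_space borel (sphere 0 1))
         (\<lambda>x. x /\<^sub>R norm x))"

definition square_integrable :: "'a measure \<Rightarrow> ('a \<Rightarrow> real) \<Rightarrow> bool"
  where "square_integrable M f \<longleftrightarrow> f \<in> borel_measurable M \<and> integrable M (\<lambda>x. (f x)\<^sup>2)"

definition L2_orthogonal :: "'a measure \<Rightarrow> ('a \<Rightarrow> real) \<Rightarrow> ('a \<Rightarrow> real) \<Rightarrow> bool"
  where "L2_orthogonal M f g \<longleftrightarrow>
    square_integrable M f \<and> square_integrable M g \<and> (LINT x|M. f x * g x) = 0"


section \<open>Forms, frames and the star operator\<close>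

text \<open>
  A constant-coefficient \<open>k\<close>-form is an alternating \<open>k\<close>-linear function of lists of length \<open>k\<close>;
  its values on lists of other lengths are irrelevant.
\<close>

definition alternating_form :: "nat \<Rightarrow> ('v::real_vector list \<Rightarrow> real) \<Rightarrow> bool"
  where "alternating_form k \<omega> \<longleftrightarrow>
    (\<forall>vs i. length vs = k \<longrightarrow> i < k \<longrightarrow> linear (\<lambda>x. \<omega> (vs[i := x]))) \<and>
    (\<forall>vs i j. length vs = k \<longrightarrow> i < j \<longrightarrow> j < k \<longrightarrow> vs ! i = vs ! j \<longrightarrow> \<omega> vs = 0)"

definition orthonormal_basis_of :: "'i set \<Rightarrow> ('i \<Rightarrow> 'v::real_inner) \<Rightarrow> 'v set \<Rightarrow> bool"
  where "orthonormal_basis_of I W S \<longleftrightarrow>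
    (\<forall>a\<in>I. \<forall>b\<in>I. W a \<bullet> W b = (if a = b then 1 else 0)) \<and> span (W ` I) = S"

text \<open>
  Determinant of a list of \<^term>\<open>CARD('k)\<close> column vectors, the \<open>r\<close>-th vector of the list being put in the
  \<open>r\<close>-th column with respect to the order of the index type.
\<close>

definition list_det :: "(real^('k::{finite,wellorder})) list \<Rightarrow> real"
  where "list_det vs = det (\<chi> i j. (vs ! card {j'. j' < j}) $ i)"

text \<open>
  Positively oriented orthonormal frames of the sphere at \<^term>\<open>p\<close>, the sphere being oriented as the
  boundary of the ball (outward normal first).
\<close>

definition direct_frame :: "real^('k::{finite,wellorder}) \<Rightarrow> (real^'k::{finite,wellorder}) list \<Rightarrow> bool"
  where "direct_frame p es \<longleftrightarrow>
    orthonormal_basis_of {..<length es} (\<lambda>i. es ! i) (tangent_space p) \<and> list_det (p # es) > 0"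

text \<open>
  A \<open>k\<close>-vector is represented by the functional \<open>\<omega> \<mapsto> \<omega>(\<eta>)\<close> it induces on \<open>k\<close>-forms. In \<open>star\<close>
  indices start at \<open>0\<close>, hence the sign \<open>(-1)^i\<close>.
\<close>

type_synonym 'v multivector = "('v list \<Rightarrow> real) \<Rightarrow> real"

definition wedge :: "'v list \<Rightarrow> 'v multivector"
  where "wedge vs = (\<lambda>\<omega>. \<omega> vs)"

definition star :: "'v::real_inner list \<Rightarrow> 'v \<Rightarrow> 'v multivector"
  where "star es X =
    (\<lambda>\<omega>. \<Sum>i<length es. (X \<bullet> es ! i) * ((- 1) ^ i * wedge (take i es @ drop (Suc i) es) \<omega>))"

text \<open>
  The 1-form \<open>X \<mapsto> \<Omega>(u, v, *X)\<close>, where \<open>*\<close> is computed in the frame \<open>es\<close> and vectors tangent to the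
  sphere are regarded as vectors of the first summand.
\<close>

definition xi_form ::
    "(('v::real_inner \<times> 'w::real_vector) list \<Rightarrow> real) \<Rightarrow> 'v \<times> 'w \<Rightarrow> 'v \<times> 'w \<Rightarrow> 'v list \<Rightarrow> 'v \<Rightarrow> real"
  where "xi_form \<Omega> u v es X = star es X (\<lambda>vs. \<Omega> (u # v # map (\<lambda>x. (x, 0)) vs))"

text \<open>Direct frames exist at every point of the sphere.\<close>

lemma rank_nth:
  "(sorted_list_of_set (UNIV::'k::{finite,wellorder} set)) ! card {j'. j' < j} = j"
proof -
  let ?L = "sorted_list_of_set (UNIV::'k set)"
  have s: "sorted_wrt (<) ?L" and st: "set ?L = UNIV" by auto
  obtain r where r: "r < length ?L" "?L ! r = j" using st by (metis UNIV_I in_set_conv_nth)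
  have "{j'. j' < j} = (\<lambda>i. ?L ! i) ` {..<r}"
  proof (intro set_eqI iffI)
    fix x assume "x \<in> {j'. j' < j}"
    then have x: "x < j" by simp
    obtain q where q: "q < length ?L" "?L ! q = x" using st by (metis UNIV_I in_set_conv_nth)
    have "q < r" 
    proof (rule ccontr)
      assume "\<not> q < r"
      then have "q = r \<or> r < q" by auto
      then have "j \<le> x" using sorted_wrt_nth_less[OF s, of r q] q r by auto
      then show False using x by simp
    qed
    then show "x \<in> (\<lambda>i. ?L ! i) ` {..<r}" using q by auto
  next
    fix x assume "x \<in> (\<lambda>i. ?L ! i) ` {..<r}"
    then show "x \<in> {j'. j' < j}" using r sorted_wrt_nth_less[OF s] by auto
  qed
  moreover have "inj_on (\<lambda>i. ?L ! i) {..<r}"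
    using r by (intro inj_onI) (simp add: nth_eq_iff_index_eq)
  ultimately have "card {j'. j' < j} = r" by (simp add: card_image)
  then show ?thesis using r by simp
qed

lemma ex_direct_frame:
  fixes p :: "real^('k::{finite,wellorder})"
  assumes c: "CARD('k) \<ge> 2" and p: "p \<in> sphere 0 1"
  shows "\<exists>es. direct_frame p es"
proof -
  let ?L = "sorted_list_of_set (UNIV::'k set)"
  have "length ?L = CARD('k)" by simp
  then obtain k T where kT: "?L = k # T" using c by (cases ?L) auto
  obtain A where A: "rotation_matrix A" "A *v (axis k 1) = p"
    using rotation_matrix_exists_basis[OF c, of p k] p by auto
  have orth: "orthogonal_matrix A" and d: "det A = 1" using A(1) by (auto simp: rotation_matrix_def)
  have ck: "column k A = p" using A(2) by (metis matrix_vector_mult_basis)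
  let ?es = "map (\<lambda>j. column j A) T"
  have L: "p # ?es = map (\<lambda>j. column j A) ?L" using kT ck by simp
  have bound: "card {j'. j' < j} < length ?L" for j :: 'k
  proof -
    have "{j'. j' < j} \<subset> UNIV" by blast
    then show ?thesis by (simp add: psubset_card_mono)
  qed
  have "(p # ?es) ! card {j'. j' < j} = column j A" for j
    unfolding L using rank_nth[of j] bound[of j] by simp
  then have "list_det (p # ?es) = det A"
    unfolding list_det_def column_def by (simp)
  then have pos: "list_det (p # ?es) > 0" using d by simp
  have dist: "distinct (k # T)" using kT by (metis distinct_sorted_list_of_set)
  have st: "set (k # T) = UNIV" using kT by (metis finite set_sorted_list_of_set)
  have on: "column i A \<bullet> column j A = (if i = j then 1 else 0)" for i j
    using orth unfolding orthogonal_matrix_orthonormal_columns orthogonal_def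
    by (auto simp: norm_eq_1)
  have T: "set T = - {k}" using dist st by auto
  have im: "(\<lambda>i. ?es ! i) ` {..<length ?es} = (\<lambda>j. column j A) ` (- {k})"
  proof -
    have "(\<lambda>i. ?es ! i) ` {..<length ?es} = set ?es" unfolding set_conv_nth[of ?es] by blast
    then show ?thesis using T by simp
  qed
  have sp: "span ((\<lambda>j. column j A) ` (- {k})) = tangent_space p" (is "span ?S = _")
  proof (rule subset_antisym)
    have "subspace (tangent_space p)" unfolding tangent_space_def subspace_def
      by (auto simp: inner_add_left)
    moreover have "?S \<subseteq> tangent_space p" by (auto simp: tangent_space_def ck[symmetric] on)
    ultimately show "span ?S \<subseteq> tangent_space p" by (simp add: span_minimal)
    show "tangent_space p \<subseteq> span ?S"
    proof
      fix x assume x: "x \<in> tangent_space p"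
      have "x = A *v (transpose A *v x)"
        using orth unfolding matrix_vector_mul_assoc orthogonal_matrix_def by (simp only: matrix_vector_mul_lid)
      also have "\<dots> = (\<Sum>j\<in>UNIV. (transpose A *v x) $ j *\<^sub>R column j A)"
        by (simp add: matrix_mult_sum scalar_mult_eq_scaleR)
      also have "\<dots> = (\<Sum>j\<in>UNIV. (x \<bullet> column j A) *\<^sub>R column j A)"
        by (intro sum.cong refl) (simp add: matrix_vector_mult_def transpose_def column_def inner_vec_def mult.commute)
      also have "\<dots> \<in> span ?S"
      proof (rule span_sum)
        fix j :: 'k
        show "(x \<bullet> column j A) *\<^sub>R column j A \<in> span ?S"
        proof (cases "j = k")
          case True then show ?thesis using x ck by (simp add: tangent_space_def span_zero)
        next
          case False then show ?thesis by (intro span_scale span_base) auto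
        qed
      qed
      finally show "x \<in> span ?S" .
    qed
  qed
  have "orthonormal_basis_of {..<length ?es} (\<lambda>i. ?es ! i) (tangent_space p)"
    unfolding orthonormal_basis_of_def im sp using dist
    by (auto simp: on nth_eq_iff_index_eq)
  then show ?thesis using pos unfolding direct_frame_def by blast
qed
end

theory Submission
  imports Defs
begin

text \<open>
  Contracting \<open>\<Omega>\<close> with \<open>W\<^sub>\<alpha>\<close> and \<open>W\<^sub>\<beta>\<close> leaves a constant alternating \<open>(m-1)\<close>-form \<open>\<omega>\<close> on
  \<open>\<real>\<^sup>m\<^sup>+\<^sup>1\<close>. Its Euclidean Hodge dual is a constant 2-form, that is, a skew-symmetric endomorphism
  \<open>A\<close>. Since a direct frame of the sphere at \<open>p\<close> together with the normal \<open>p\<close> is a direct orthonormal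
  basis of \<open>\<real>\<^sup>m\<^sup>+\<^sup>1\<close>, the star operator of the sphere is the Euclidean one contracted with \<open>p\<close>, and
  therefore \<open>\<xi>(X) = \<langle>A p, X\<rangle>\<close> (lemma \<open>xi_form_skew\<close>). Hence \<open>h p = \<langle>A p, \<nabla>f p\<rangle>\<close> is the derivative of \<open>f\<close>
  along the Killing field \<open>p \<mapsto> A p\<close>, and both claims are instances of the invariance of the
  sphere under the rotations that this field generates.

  \<^item> Killing fields commute with the Laplacian. To see this without charts, let \<open>F\<close> extend \<open>f\<close> to a
    neighbourhood of the sphere and write \<open>L\<^sub>A F (x) = DF(x)(A x)\<close>. On the sphere \<open>\<Delta>f\<close> is the restriction
    of \<open>\<Delta>F - E(E F) - (m-1) E F\<close>, where \<open>E\<close> is \<open>L\<^sub>A\<close> for \<open>A = id\<close>, the Euler field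
    (\<open>sphere_laplacian_extension\<close>). The commutator of \<open>\<partial>\<^sub>v\<close> with \<open>L\<^sub>A\<close> is \<open>\<partial>\<^sub>A\<^sub>v\<close>, and it follows that
    \<open>L\<^sub>A\<close> commutes with \<open>E\<close>, and with \<open>\<Delta>\<close> because \<open>A\<close> is skew. The eigenvalue equation
    holds for \<open>F\<close> on the sphere only, but \<open>L\<^sub>A\<close> differentiates in directions tangent to the sphere, so it may
    be applied to that equation (\<open>eigenspace_lin_deriv\<close>).

  \<^item> Rotations preserve the integral of \<open>f\<^sup>2\<close>, and the derivative of this integral along the flow is
    twice the integral of \<open>f L\<^sub>A f\<close>, which is therefore \<open>0\<close>. Here \<open>A\<close> is first decomposed into generators of
    rotations of coordinate planes, whose flows are explicit (\<open>integral_mult_lin_deriv\<close>).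
\<close>

section \<open>Exterior algebra\<close>

lemma alternating_formD_linear:
  assumes "alternating_form k \<omega>" "Suc (length xs + length ys) = k"
  shows "linear (\<lambda>x. \<omega> (xs @ x # ys))"
proof -
  have "length (xs @ 0 # ys) = k" "length xs < k" using assms(2) by auto
  then have "linear (\<lambda>x. \<omega> ((xs @ 0 # ys)[length xs := x]))"
    using assms(1) unfolding alternating_form_def by blast
  then show ?thesis by simp
qed

lemma alternating_formD_eq:
  assumes "alternating_form k \<omega>" "Suc (Suc (length xs + length ys + length zs)) = k"
  shows "\<omega> (xs @ v # ys @ v # zs) = 0"
proof -
  let ?vs = "xs @ v # ys @ v # zs"
  have "length ?vs = k" "length xs < Suc (length xs + length ys)"
    "Suc (length xs + length ys) < k" "?vs ! length xs = ?vs ! Suc (length xs + length ys)"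
    using assms(2) by (auto simp: nth_append)
  then show ?thesis using assms(1) unfolding alternating_form_def by blast
qed

lemma alternating_formI:
  assumes lin: "\<And>xs ys. Suc (length xs + length ys) = k \<Longrightarrow> linear (\<lambda>x. \<omega> (xs @ x # ys))"
    and eq: "\<And>xs v ys zs. Suc (Suc (length xs + length ys + length zs)) = k
               \<Longrightarrow> \<omega> (xs @ v # ys @ v # zs) = 0"
  shows "alternating_form k \<omega>"
  unfolding alternating_form_def
proof (intro conjI allI impI)
  fix vs :: "'a list" and i
  assume "length vs = k" "i < k"
  then have "linear (\<lambda>x. \<omega> (take i vs @ x # drop (Suc i) vs))" by (intro lin) auto
  then show "linear (\<lambda>x. \<omega> (vs[i := x]))"
    using \<open>length vs = k\<close> \<open>i < k\<close> by (simp add: upd_conv_take_nth_drop)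
next
  fix vs :: "'a list" and i j
  assume *: "length vs = k" "i < j" "j < k" "vs ! i = vs ! j"
  let ?ys = "take (j - Suc i) (drop (Suc i) vs)"
  have "drop (Suc i) vs = ?ys @ vs ! j # drop (Suc j) vs"
    using * id_take_nth_drop[of "j - Suc i" "drop (Suc i) vs"] by (simp)
  then have "vs = take i vs @ vs ! j # ?ys @ vs ! j # drop (Suc j) vs"
    using * id_take_nth_drop[of i vs] by simp
  moreover have "\<omega> (take i vs @ vs ! j # ?ys @ vs ! j # drop (Suc j) vs) = 0"
    using * by (intro eq) auto
  ultimately show "\<omega> vs = 0" by simp
qed

lemma alternating_form_swap:
  assumes "alternating_form k \<omega>" "Suc (Suc (length xs + length ys + length zs)) = k"
  shows "\<omega> (xs @ u # ys @ v # zs) = - \<omega> (xs @ v # ys @ u # zs)"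
proof -
  have l1: "linear (\<lambda>x. \<omega> (xs @ x # ys @ y # zs))" for y
    using assms(2) by (intro alternating_formD_linear[OF assms(1)]) auto
  have l2: "linear (\<lambda>y. \<omega> (xs @ x # ys @ y # zs))" for x
    using assms(2) alternating_formD_linear[OF assms(1), of "xs @ x # ys" zs] by simp
  have "\<omega> (xs @ (u + v) # ys @ (u + v) # zs) =
      (\<omega> (xs @ u # ys @ u # zs) + \<omega> (xs @ u # ys @ v # zs)) +
      (\<omega> (xs @ v # ys @ u # zs) + \<omega> (xs @ v # ys @ v # zs))"
    by (simp only: linear_add[OF l1] linear_add[OF l2])
  then show ?thesis
    using alternating_formD_eq[OF assms, of "u + v"] alternating_formD_eq[OF assms, of u]
      alternating_formD_eq[OF assms, of v] by linarith
qed

text \<open>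
  Moving \<open>v\<close> past \<open>ys\<close> takes one adjacent transposition for each entry of \<open>ys\<close>.
\<close>

lemma alternating_form_move:
  assumes "alternating_form k \<omega>" "Suc (length xs + length ys + length zs) = k"
  shows "\<omega> (xs @ v # ys @ zs) = (- 1) ^ length ys * \<omega> (xs @ ys @ v # zs)"
  using assms(2)
proof (induction ys arbitrary: xs)
  case (Cons y ys)
  have "\<omega> (xs @ v # y # ys @ zs) = - \<omega> (xs @ y # v # ys @ zs)"
    using alternating_form_swap[OF assms(1), of xs "[]" "ys @ zs" v y] Cons.prems by simp
  then show ?case using Cons.IH[of "xs @ [y]"] Cons.prems by simp
qed simp

lemma star_Nil: "star [] y \<omega> = 0"
  by (simp add: star_def)

text \<open>
  The sum that defines \<^const>\<open>star\<close> makes sense for every list: it is the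
  value on the list of the exterior product of the 1-form \<open>\<langle>y, \<cdot>\<rangle>\<close> with \<open>\<omega>\<close>. The next two lemmas are
  the expansion of that product along the first entry and along an initial segment.
\<close>

lemma star_Cons: "star (v # vs) y \<omega> = (y \<bullet> v) * \<omega> vs - star vs y (\<lambda>ws. \<omega> (v # ws))"
  by (simp add: star_def wedge_def sum.lessThan_Suc_shift sum_negf del: sum.lessThan_Suc)

lemma star_append:
  "star (xs @ ys) y \<omega> =
     star xs y (\<lambda>ws. \<omega> (ws @ ys)) + (- 1) ^ length xs * star ys y (\<lambda>ws. \<omega> (xs @ ws))"
  by (induction xs arbitrary: \<omega>) (simp_all add: star_Nil star_Cons algebra_simps)

lemma star_linear:
  assumes "\<And>ws. Suc (length ws) = length vs \<Longrightarrow> linear (\<lambda>x. \<Phi> x ws)"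
  shows "linear (\<lambda>x. star vs y (\<Phi> x))"
  unfolding star_def wedge_def
proof (rule linear_compose_sum, rule ballI)
  fix i assume "i \<in> {..<length vs}"
  then have "linear (\<lambda>x. \<Phi> x (take i vs @ drop (Suc i) vs))" by (intro assms) auto
  from linear_compose_scale_right[OF this, of "(y \<bullet> vs ! i) * (- 1) ^ i"]
  show "linear (\<lambda>x. (y \<bullet> vs ! i) * ((- 1) ^ i * \<Phi> x (take i vs @ drop (Suc i) vs)))"
    by (simp add: mult.assoc)
qed

lemma star_linear_vector: "linear (\<lambda>y. star vs y \<omega>)"
  by (auto intro!: linearI simp: star_def inner_add_left sum.distrib sum_distrib_left algebra_simps)

lemma star_eq_0:
  assumes "\<And>ws. Suc (length ws) = length vs \<Longrightarrow> \<Phi> ws = 0"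
  shows "star vs y \<Phi> = 0"
  unfolding star_def wedge_def by (intro sum.neutral ballI) (simp add: assms)

text \<open>
  If \<open>v\<close> occurs twice, only the two terms that omit one of its occurrences survive. The
  arguments of \<open>\<omega>\<close> in them differ by moving \<open>v\<close> past the entries in between, and by
  \<open>alternating_form_move\<close> the resulting sign makes the terms cancel.
\<close>

lemma alternating_form_star:
  assumes \<omega>: "alternating_form k \<omega>"
  shows "alternating_form (Suc k) (\<lambda>vs. star vs y \<omega>)"
proof (rule alternating_formI)
  fix xs ys :: "'a list" assume len: "Suc (length xs + length ys) = Suc k"
  have "linear (\<lambda>x. star xs y (\<lambda>ws. \<omega> (ws @ x # ys)))"
    using len by (intro star_linear alternating_formD_linear[OF \<omega>]) auto
  moreover have "linear (\<lambda>x. star ys y (\<lambda>ws. \<omega> (xs @ x # ws)))"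
    using len by (intro star_linear alternating_formD_linear[OF \<omega>]) auto
  moreover have "linear (\<lambda>x. (y \<bullet> x) * \<omega> (xs @ ys))"
    by (auto intro!: linearI simp: inner_add_right algebra_simps)
  ultimately have "linear (\<lambda>x. star xs y (\<lambda>ws. \<omega> (ws @ x # ys)) + (- 1) ^ length xs *
     ((y \<bullet> x) * \<omega> (xs @ ys) - star ys y (\<lambda>ws. \<omega> (xs @ x # ws))))"
    using linear_compose_scale_right[where c = "(- 1) ^ length xs" and 'b=real]
    by (intro linear_compose_add) (auto intro!: linear_compose_sub)
  then show "linear (\<lambda>x. star (xs @ x # ys) y \<omega>)"
    by (simp add: star_append star_Cons)
next
  fix xs ys zs :: "'a list" and v
  assume len: "Suc (Suc (length xs + length ys + length zs)) = Suc k"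
  have 1: "star xs y (\<lambda>ws. \<omega> (ws @ v # ys @ v # zs)) = 0"
    using len by (intro star_eq_0 alternating_formD_eq[OF \<omega>]) auto
  have 2: "star ys y (\<lambda>ws. \<omega> (xs @ v # ws @ v # zs)) = 0"
    using len by (intro star_eq_0 alternating_formD_eq[OF \<omega>]) auto
  have 3: "star zs y (\<lambda>ws. \<omega> (xs @ v # ys @ v # ws)) = 0"
    using len by (intro star_eq_0 alternating_formD_eq[OF \<omega>]) auto
  show "star (xs @ v # ys @ v # zs) y \<omega> = 0"
    using alternating_form_move[OF \<omega>, of xs ys zs v] len
    by (simp add: star_append star_Cons 1 2 3)
qed

lemma alternating_form_contract_pair:
  assumes "alternating_form (Suc (Suc k)) \<Omega>"
  shows "alternating_form k (\<lambda>vs. \<Omega> (u # v # map (\<lambda>x. (x, 0)) vs))"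
proof (rule alternating_formI)
  fix xs ys :: "'a list" assume len: "Suc (length xs + length ys) = k"
  let ?j = "\<lambda>x::'a. (x, 0::'b)"
  have "linear (\<lambda>x. \<Omega> ((u # v # map ?j xs) @ x # map ?j ys))"
    by (rule alternating_formD_linear[OF assms]) (use len in auto)
  moreover have "linear ?j" by (auto intro!: linearI)
  ultimately have "linear ((\<lambda>x. \<Omega> ((u # v # map ?j xs) @ x # map ?j ys)) \<circ> ?j)"
    by (rule linear_compose[rotated])
  then show "linear (\<lambda>x. \<Omega> (u # v # map ?j (xs @ x # ys)))" by (simp add: o_def)
next
  fix xs ys zs :: "'a list" and w
  assume len: "Suc (Suc (length xs + length ys + length zs)) = k"
  let ?j = "\<lambda>x::'a. (x, 0::'b)"
  have "\<Omega> ((u # v # map ?j xs) @ ?j w # map ?j ys @ ?j w # map ?j zs) = 0"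
    by (rule alternating_formD_eq[OF assms]) (use len in auto)
  then show "\<Omega> (u # v # map ?j (xs @ w # ys @ w # zs)) = 0" by simp
qed

section \<open>Forms of top degree\<close>

text \<open>
  A form of degree \<open>CARD('k)\<close> is regarded as a function of families indexed by \<^typ>\<open>'k\<close>, like the
  rows of a matrix, by listing the family in the order of the index type.
\<close>

lemma top_form_linear:
  fixes g :: "'k::{finite,wellorder} \<Rightarrow> 'v::real_vector"
  assumes "alternating_form CARD('k) \<Theta>"
  shows "linear (\<lambda>x. \<Theta> (map (g(j := x)) (sorted_list_of_set UNIV)))"
proof -
  let ?L = "sorted_list_of_set (UNIV::'k set)"
  obtain xs ys where L: "?L = xs @ j # ys" by (metis UNIV_I finite set_sorted_list_of_set split_list)
  then have d: "distinct (xs @ j # ys)" by (metis distinct_sorted_list_of_set)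
  have "Suc (length xs + length ys) = CARD('k)" using arg_cong[OF L, of length] by simp
  then have "linear (\<lambda>x. \<Theta> (map g xs @ x # map g ys))"
    by (intro alternating_formD_linear[OF assms]) simp
  moreover have "map (g(j := x)) ?L = map g xs @ x # map g ys" for x
    unfolding L using d by auto
  ultimately show ?thesis by simp
qed

lemma top_form_eq_0:
  fixes g :: "'k::{finite,wellorder} \<Rightarrow> 'v::real_vector"
  assumes \<Theta>: "alternating_form CARD('k) \<Theta>" and ne: "i \<noteq> j" "g i = g j"
  shows "\<Theta> (map g (sorted_list_of_set UNIV)) = 0"
  using ne
proof (induction i j rule: linorder_wlog)
  case (le i j)
  let ?L = "sorted_list_of_set (UNIV::'k set)"
  have "\<exists>xs ys zs. ?L = xs @ i # ys @ j # zs \<or> ?L = xs @ j # ys @ i # zs"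
  proof -
    obtain xs ys where 1: "?L = xs @ i # ys" by (metis UNIV_I finite set_sorted_list_of_set split_list)
    then have "j \<in> set xs \<or> j \<in> set ys" using le
      by (metis UNIV_I Un_iff finite set_ConsD set_append set_sorted_list_of_set)
    then show ?thesis
    proof
      assume "j \<in> set xs"
      then obtain us vs where "xs = us @ j # vs" by (metis split_list)
      then show ?thesis using 1 by auto
    next
      assume "j \<in> set ys"
      then obtain us vs where "ys = us @ j # vs" by (metis split_list)
      then show ?thesis using 1 by auto
    qed
  qed
  then obtain xs ys zs where L: "?L = xs @ i # ys @ j # zs \<or> ?L = xs @ j # ys @ i # zs" by blast
  then have "Suc (Suc (length xs + length ys + length zs)) = CARD('k)"
    by (elim disjE) (drule arg_cong[where f = length], simp)+
  then have "\<Theta> (map g xs @ g i # map g ys @ g i # map g zs) = 0"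
    by (intro alternating_formD_eq[OF \<Theta>]) simp
  then show ?case using L le by auto
next
  case (sym i j) then show ?case by auto
qed

lemma top_form_scale:
  fixes g :: "'k::{finite,wellorder} \<Rightarrow> 'v::real_vector"
  assumes "alternating_form CARD('k) \<Theta>"
  shows "\<Theta> (map (\<lambda>j. d j *\<^sub>R g j) (sorted_list_of_set UNIV)) =
           prod d UNIV * \<Theta> (map g (sorted_list_of_set UNIV))"
proof -
  have "\<Theta> (map (\<lambda>j. if j \<in> S then d j *\<^sub>R g j else g j) (sorted_list_of_set UNIV)) =
           prod d S * \<Theta> (map g (sorted_list_of_set UNIV))" if "finite S" for S
    using that
  proof (induction S rule: finite_induct)
    case (insert a S)
    let ?g = "\<lambda>j. if j \<in> S then d j *\<^sub>R g j else g j"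
    have "(\<lambda>j. if j \<in> insert a S then d j *\<^sub>R g j else g j) = ?g(a := d a *\<^sub>R g a)"
      using insert.hyps by auto
    moreover have "?g(a := g a) = ?g" using insert.hyps by auto
    ultimately show ?case
      using linear_cmul[OF top_form_linear[OF assms, of ?g a], of "d a" "g a"] insert by simp
  qed (simp)
  from this[of UNIV] show ?thesis by simp
qed

lemma top_form_row_add:
  fixes g :: "'k::{finite,wellorder} \<Rightarrow> 'v::real_vector"
  assumes "alternating_form CARD('k) \<Theta>" "i \<noteq> j"
  shows "\<Theta> (map (g(i := g i + c *\<^sub>R g j)) (sorted_list_of_set UNIV)) =
           \<Theta> (map g (sorted_list_of_set UNIV))"
proof -
  have "\<Theta> (map (g(i := g j)) (sorted_list_of_set UNIV)) = 0"
    by (rule top_form_eq_0[OF assms]) (use assms(2) in auto)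
  then show ?thesis
    using linear_add[OF top_form_linear[OF assms(1), of g i]]
      linear_cmul[OF top_form_linear[OF assms(1), of g i]] by simp
qed

lemma top_form_swap:
  fixes g :: "'k::{finite,wellorder} \<Rightarrow> 'v::real_vector"
  assumes "alternating_form CARD('k) \<Theta>" "i \<noteq> j"
  shows "\<Theta> (map (g(i := g j, j := g i)) (sorted_list_of_set UNIV)) =
           - \<Theta> (map g (sorted_list_of_set UNIV))"
proof -
  let ?D = "\<lambda>g. \<Theta> (map g (sorted_list_of_set UNIV))"
  let ?s = "g i + g j"
  have "?D (g(i := ?s, j := ?s)) = 0" by (rule top_form_eq_0[OF assms]) (use assms(2) in auto)
  moreover have "?D (g(i := ?s, j := ?s)) = ?D (g(i := ?s, j := g i)) + ?D (g(i := ?s, j := g j))"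
    using linear_add[OF top_form_linear[OF assms(1), of "g(i := ?s)" j]] by simp
  moreover have "?D (g(i := ?s, j := x)) = ?D (g(i := g i, j := x)) + ?D (g(i := g j, j := x))" for x
    using linear_add[OF top_form_linear[OF assms(1), of "g(j := x)" i]] assms(2)
    by (simp add: fun_upd_twist)
  moreover have "?D (g(i := g i, j := g i)) = 0" "?D (g(i := g j, j := g j)) = 0"
    by (rule top_form_eq_0[OF assms]; use assms(2) in auto)+
  moreover have "g(i := g i, j := g j) = g" by auto
  ultimately show ?thesis by simp
qed

text \<open>
  Multiplication by elementary matrices changes the rows by scalings, swaps and additions, to
  which an alternating form responds by the same factors as the determinant. Every
  matrix is a product of elementary matrices and matrices with a zero row.
\<close>

lemma top_form_mult:
  fixes A :: "((real, 'k::{finite,wellorder}) vec, 'k) vec" and g :: "'k \<Rightarrow> 'v::real_vector"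
  assumes \<Theta>: "alternating_form CARD('k) \<Theta>"
  shows "\<Theta> (map (\<lambda>j. \<Sum>k\<in>UNIV. A $ j $ k *\<^sub>R g k) (sorted_list_of_set UNIV)) =
           det A * \<Theta> (map g (sorted_list_of_set UNIV))"
proof (induction A arbitrary: g rule: induct_matrix_elementary)
  case (1 A B)
  have "(\<Sum>k\<in>UNIV. (A ** B) $ j $ k *\<^sub>R g k) =
     (\<Sum>l\<in>UNIV. A $ j $ l *\<^sub>R (\<Sum>k\<in>UNIV. B $ l $ k *\<^sub>R g k))" for j
    unfolding matrix_matrix_mult_def
    by (simp add: scaleR_sum_left scaleR_sum_right) (rule sum.swap)
  then show ?case by (simp add: 1 det_mul)
next
  case (2 A i)
  then have z: "A $ i $ k = 0" for k by (simp add: row_def vec_eq_iff)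
  let ?h = "\<lambda>j. \<Sum>k\<in>UNIV. A $ j $ k *\<^sub>R g k"
  have "?h = ?h(i := 0)" by (auto simp: z)
  then have "\<Theta> (map ?h (sorted_list_of_set UNIV)) = 0"
    using linear_0[OF top_form_linear[OF \<Theta>, of ?h i]] by metis
  moreover have "det A = 0" using 2 by (rule det_zero_row)
  ultimately show ?case by simp
next
  case (3 A)
  have "(\<Sum>k\<in>UNIV. A $ j $ k *\<^sub>R g k) = A $ j $ j *\<^sub>R g j" for j
  proof -
    have "(\<Sum>k\<in>UNIV. A $ j $ k *\<^sub>R g k) = (\<Sum>k\<in>UNIV. if k = j then A $ j $ j *\<^sub>R g j else 0)"
      by (intro sum.cong) (auto simp: 3)
    then show ?thesis by simp
  qed
  then show ?case
    using top_form_scale[OF \<Theta>, of "\<lambda>j. A $ j $ j" g] det_diagonal[of A] 3 by simp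
next
  case (4 m n)
  let ?M = "\<chi> i j. mat 1 $ i $ Transposition.transpose m n j :: ((real, 'k) vec, 'k) vec"
  have "det ?M = - 1"
    using det_permute_columns[OF permutes_swap_id[of m UNIV n], of "mat 1 :: ((real, 'k) vec, 'k) vec"] 4
    by (simp add: sign_swap_id)
  moreover have "(\<lambda>j. \<Sum>k\<in>UNIV. ?M $ j $ k *\<^sub>R g k) = g(m := g n, n := g m)"
  proof
    fix j
    have "(\<Sum>k\<in>UNIV. ?M $ j $ k *\<^sub>R g k) =
      (\<Sum>k\<in>UNIV. if k = Transposition.transpose m n j then g k else 0)"
      by (intro sum.cong) (auto simp: mat_def Transposition.transpose_def)
    then show "(\<Sum>k\<in>UNIV. ?M $ j $ k *\<^sub>R g k) = (g(m := g n, n := g m)) j"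
      by (simp add: Transposition.transpose_def)
  qed
  ultimately show ?case using top_form_swap[OF \<Theta> 4, of g] by (simp only: mult_minus1)
next
  case (5 m n c)
  let ?M = "\<chi> i j. if i = m \<and> j = n then c else of_bool (i = j) :: ((real, 'k) vec, 'k) vec"
  have "det ?M = det (\<chi> k. if k = m then row m (mat 1) + c *s row n (mat 1) else row k (mat 1 :: ((real, 'k) vec, 'k) vec))"
    using 5 by (intro arg_cong[where f = det]) (auto simp: vec_eq_iff row_def mat_def)
  then have "det ?M = 1" using det_row_operation[OF 5, of "mat 1" c] by simp
  moreover have "(\<lambda>j. \<Sum>k\<in>UNIV. ?M $ j $ k *\<^sub>R g k) = g(m := g m + c *\<^sub>R g n)"
  proof
    fix j
    have "(\<Sum>k\<in>UNIV. ?M $ j $ k *\<^sub>R g k) =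
      (\<Sum>k\<in>UNIV. (if k = j then g k else 0) + (if k = n then if j = m then c *\<^sub>R g n else 0 else 0))"
      using 5 by (intro sum.cong) auto
    then show "(\<Sum>k\<in>UNIV. ?M $ j $ k *\<^sub>R g k) = (g(m := g m + c *\<^sub>R g n)) j"
      by (simp add: sum.distrib)
  qed
  ultimately show ?case using top_form_row_add[OF \<Theta> 5, of g c] by (simp only: mult_1)
qed

text \<open>
  The space of alternating forms of top degree is one-dimensional. This is what makes a quantity
  computed in a direct frame independent of the frame.
\<close>

lemma top_form_list_det:
  fixes vs :: "(real^('k::{finite,wellorder})) list"
  assumes \<Theta>: "alternating_form CARD('k) \<Theta>" and len: "length vs = CARD('k)"
  shows "\<Theta> vs = list_det vs * \<Theta> (map (\<lambda>j. axis j 1) (sorted_list_of_set UNIV))"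
proof -
  let ?L = "sorted_list_of_set (UNIV::'k set)"
  define A :: "((real, 'k) vec, 'k) vec" where "A = (\<chi> j. vs ! card {j'. j' < j})"
  have "card {j'. j' < ?L ! i} = i" if "i < CARD('k)" for i
  proof -
    let ?r = "card {j'. j' < ?L ! i}"
    have "{j'. j' < ?L ! i} \<subset> UNIV" by blast
    then have "?r < length ?L" by (simp add: psubset_card_mono)
    then show ?thesis using rank_nth[of "?L ! i"] that by (simp add: nth_eq_iff_index_eq)
  qed
  then have "vs = map (\<lambda>j. A $ j) ?L"
    using len by (intro nth_equalityI) (auto simp: A_def)
  moreover have "(\<Sum>k\<in>UNIV. A $ j $ k *\<^sub>R axis k 1) = A $ j" for j
    using basis_expansion[of "A $ j"] by (simp add: scalar_mult_eq_scaleR)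
  moreover have "list_det vs = det A"
    using det_transpose[of A] by (simp add: list_det_def A_def transpose_def)
  ultimately show ?thesis using top_form_mult[OF \<Theta>, of A "\<lambda>j. axis j 1"] by simp
qed

section \<open>The one-form is contraction with a skew endomorphism\<close>

lemma direct_frame_length:
  assumes "direct_frame (p :: real^('k::{finite,wellorder})) es" "norm p = 1"
  shows "Suc (length es) = CARD('k)"
proof -
  have on: "\<And>i j. i < length es \<Longrightarrow> j < length es \<Longrightarrow> es ! i \<bullet> es ! j = (if i = j then 1 else 0)"
    and sp: "span ((\<lambda>i. es ! i) ` {..<length es}) = tangent_space p"
    using assms unfolding direct_frame_def orthonormal_basis_of_def by auto
  let ?S = "(\<lambda>i. es ! i) ` {..<length es}"
  have "p \<noteq> 0" using assms(2) by auto
  have inj: "inj_on (\<lambda>i. es ! i) {..<length es}" by (intro inj_onI) (metis lessThan_iff on zero_neq_one)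
  have "independent ?S"
  proof (rule pairwise_orthogonal_independent)
    show "pairwise orthogonal ?S" by (auto simp: pairwise_def orthogonal_def on)
    show "0 \<notin> ?S" using on by fastforce
  qed
  then have "dim (tangent_space p) = length es"
    using inj dim_span_eq_card_independent[of ?S] by (simp add: card_image sp)
  moreover have "dim (tangent_space p) = CARD('k) - 1"
    using dim_hyperplane[of p] \<open>p \<noteq> 0\<close> unfolding tangent_space_def
    by (simp add: inner_commute)
  moreover have "CARD('k) > 0" by simp
  ultimately show ?thesis by linarith
qed

lemma direct_frame_tangent:
  assumes "direct_frame p es" "i < length es"
  shows "es ! i \<bullet> p = 0"
proof -
  have "es ! i \<in> span ((\<lambda>i. es ! i) ` {..<length es})"
    by (rule span_base) (use assms(2) in simp)
  moreover have "span ((\<lambda>i. es ! i) ` {..<length es}) = tangent_space p"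
    using assms(1) unfolding direct_frame_def orthonormal_basis_of_def by (elim conjE)
  ultimately have "es ! i \<in> tangent_space p" by (simp only:)
  then show ?thesis by (simp add: tangent_space_def)
qed

lemma star_direct_frame_normal:
  assumes "direct_frame p es" shows "star es p \<Phi> = 0"
  using direct_frame_tangent[OF assms] by (simp add: star_def inner_commute)

text \<open>
  The matrix with columns \<open>p, e\<^sub>1, \<dots>, e\<^sub>m\<close> is orthogonal, so its determinant is \<open>1\<close> or \<open>-1\<close>, and the
  orientation selects \<open>1\<close>.
\<close>

lemma direct_frame_list_det:
  assumes fr: "direct_frame (p :: real^('k::{finite,wellorder})) es" and p: "norm p = 1"
  shows "list_det (p # es) = 1"
proof -
  let ?vs = "p # es"
  have on: "\<And>i j. i < length es \<Longrightarrow> j < length es \<Longrightarrow> es ! i \<bullet> es ! j = (if i = j then 1 else 0)"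
    using fr unfolding direct_frame_def orthonormal_basis_of_def by auto
  note tan = direct_frame_tangent[OF fr]
  have on': "?vs ! i \<bullet> ?vs ! j = (if i = j then 1 else 0)" if "i < length ?vs" "j < length ?vs" for i j
    using that p tan on by (cases i; cases j) (auto simp: inner_commute norm_eq_1)
  let ?r = "\<lambda>j. card {j'. j' < (j::'k)}"
  let ?M = "\<chi> i j. (?vs ! ?r j) $ i :: ((real, 'k) vec, 'k) vec"
  have r: "?r j < length ?vs" for j
  proof -
    have "{j'. j' < j} \<subset> UNIV" by blast
    then show ?thesis using direct_frame_length[OF assms] by (simp add: psubset_card_mono)
  qed
  have inj: "?r i = ?r j \<Longrightarrow> i = j" for i j by (metis rank_nth)
  have col: "column j ?M = ?vs ! ?r j" for j by (simp add: column_def vec_eq_iff)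
  have "orthogonal_matrix ?M"
    unfolding orthogonal_matrix_orthonormal_columns orthogonal_def col norm_eq_1
    using on'[OF r r] inj by auto
  then have "det ?M = 1 \<or> det ?M = - 1" by (rule det_orthogonal_matrix)
  moreover have "list_det ?vs = det ?M" by (simp add: list_det_def)
  moreover have "list_det ?vs > 0" using fr by (simp add: direct_frame_def)
  ultimately show ?thesis by linarith
qed

text \<open>
  Let \<open>\<Theta> x y\<close> be the top-degree form \<open>x \<and> y \<and> \<omega>\<close>. On the list \<open>p, e\<^sub>1, \<dots>, e\<^sub>m\<close> the factor \<open>\<langle>p, \<cdot>\<rangle>\<close>
  sees the first entry only, so \<open>\<Theta> p X\<close> takes there the value of \<open>\<omega>\<close> on \<open>*X\<close>. By
  \<open>top_form_list_det\<close> this equals the value of \<open>\<Theta> p X\<close> on the standard basis, which does not depend on the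
  frame and is bilinear in \<open>p\<close> and \<open>X\<close>. Skewness holds since \<open>*p = 0\<close> in a frame at \<open>p\<close>.
\<close>

lemma xi_form_skew:
  fixes \<Omega> :: "((real^('k::{finite,wellorder})) \<times> 'w::real_vector) list \<Rightarrow> real"
  assumes \<Omega>: "alternating_form CARD('k) \<Omega>" and c: "CARD('k) \<ge> 2"
  obtains A :: "real^('k::{finite,wellorder}) \<Rightarrow> real^('k::{finite,wellorder})" where "linear A" "\<And>x. A x \<bullet> x = 0"
    "\<And>p es X. norm p = 1 \<Longrightarrow> direct_frame p es \<Longrightarrow> xi_form \<Omega> u v es X = A p \<bullet> X"
proof -
  define \<omega> where "\<omega> = (\<lambda>vs. \<Omega> (u # v # map (\<lambda>x::(real, 'k) vec. (x, 0)) vs))"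
  define \<Theta> where "\<Theta> = (\<lambda>x y vs. star vs x (\<lambda>ws. star ws y \<omega>))"
  define b where "b = map (\<lambda>j::'k. axis j (1::real)) (sorted_list_of_set UNIV)"
  obtain k where k: "CARD('k) = Suc (Suc k)" using le_Suc_ex[OF c] by auto
  have "alternating_form (Suc (Suc k)) \<Omega>" using \<Omega> unfolding k .
  from alternating_form_contract_pair[OF this] have \<omega>: "alternating_form k \<omega>" unfolding \<omega>_def .
  have \<Theta>: "alternating_form CARD('k) (\<Theta> x y)" for x y
    unfolding \<Theta>_def k by (rule alternating_form_star[OF alternating_form_star[OF \<omega>]])
  have lin1: "linear (\<lambda>x. \<Theta> x y b)" for y unfolding \<Theta>_def by (rule star_linear_vector)
  have lin2: "linear (\<lambda>y. \<Theta> x y b)" for x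
    unfolding \<Theta>_def by (rule star_linear) (rule star_linear_vector)
  have key: "\<Theta> p X b = star es X \<omega>" if p: "norm p = 1" and fr: "direct_frame p es" for p X es
  proof -
    have "\<Theta> p X (p # es) = star es X \<omega>"
      using p star_direct_frame_normal[OF fr] by (simp add: \<Theta>_def star_Cons norm_eq_1)
    moreover have "\<Theta> p X (p # es) = \<Theta> p X b"
      using top_form_list_det[OF \<Theta>, of "p # es"] direct_frame_list_det[OF fr p]
        direct_frame_length[OF fr p] by (simp add: b_def)
    ultimately show ?thesis by simp
  qed
  define A where "A x = (\<Sum>e\<in>Basis. \<Theta> x e b *\<^sub>R e)" for x
  have A: "A x \<bullet> y = \<Theta> x y b" for x y
  proof -
    have "A x \<bullet> y = (\<Sum>e\<in>Basis. (y \<bullet> e) * \<Theta> x e b)"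
      unfolding A_def inner_sum_left by (simp add: inner_commute mult.commute)
    also have "\<dots> = \<Theta> x (\<Sum>e\<in>Basis. (y \<bullet> e) *\<^sub>R e) b"
      by (simp add: linear_sum[OF lin2] linear_cmul[OF lin2])
    finally show ?thesis by (simp add: euclidean_representation)
  qed
  have linA: "linear A" unfolding A_def
    using linear_add[OF lin1] linear_cmul[OF lin1]
    by (intro linearI) (simp_all add: scaleR_left_distrib sum.distrib scaleR_sum_right)
  show thesis
  proof
    show "linear A" by (rule linA)
    show "xi_form \<Omega> u v es X = A p \<bullet> X" if "norm p = 1" "direct_frame p es" for p es X
      using key[OF that] by (simp add: A xi_form_def \<omega>_def)
    show "A x \<bullet> x = 0" for x
    proof (cases "x = 0")
      case False
      define p where "p = x /\<^sub>R norm x"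
      have p: "norm p = 1" using False by (simp add: p_def)
      then obtain es where es: "direct_frame p es" using ex_direct_frame[OF c, of p] by auto
      have "A p \<bullet> p = 0" using key[OF p es, of p] star_direct_frame_normal[OF es] by (simp add: A)
      moreover have "A x \<bullet> x = A (norm x *\<^sub>R p) \<bullet> (norm x *\<^sub>R p)" using False by (simp add: p_def)
      ultimately show ?thesis by (simp only: linear_cmul[OF linA] inner_scaleR_left inner_scaleR_right mult_zero_right)
    qed (simp add: linear_0[OF linA])
  qed
qed

section \<open>Directional derivatives of smooth functions\<close>

definition smooth_on :: "'a::euclidean_space set \<Rightarrow> ('a \<Rightarrow> real) \<Rightarrow> bool"
  where "smooth_on U F \<longleftrightarrow> (\<forall>k. Ck_on k U F)"

definition dir_deriv :: "'a::euclidean_space \<Rightarrow> ('a \<Rightarrow> real) \<Rightarrow> 'a \<Rightarrow> real"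
  where "dir_deriv v F x = frechet_derivative F (at x) v"

lemma smooth_on_has_derivative:
  assumes "smooth_on U F" "open U" "x \<in> U"
  shows "(F has_derivative (\<lambda>v. dir_deriv v F x)) (at x)"
proof -
  have "Ck_on 1 U F" using assms(1) by (simp only: smooth_on_def)
  then have "F differentiable_on U" by simp
  then have "F differentiable at x"
    using assms(2,3) by (simp add: differentiable_on_eq_differentiable_at)
  then show ?thesis unfolding dir_deriv_def by (simp add: frechet_derivative_works)
qed

lemma dir_deriv_eqI: "(F has_derivative D) (at x) \<Longrightarrow> dir_deriv v F x = D v"
  unfolding dir_deriv_def by (metis frechet_derivative_at)

lemma smooth_on_dir_deriv:
  assumes "smooth_on U F" shows "smooth_on U (dir_deriv v F)"
  unfolding smooth_on_def
proof
  fix k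
  have "Ck_on (Suc k) U F" using assms by (simp only: smooth_on_def)
  then show "Ck_on k U (dir_deriv v F)" by (simp add: dir_deriv_def[abs_def])
qed

lemma smooth_on_continuous: "smooth_on U F \<Longrightarrow> continuous_on U F"
  unfolding smooth_on_def by (metis Ck_on.simps(1))

lemma dir_deriv_cong:
  assumes "open U" "x \<in> U" "\<And>y. y \<in> U \<Longrightarrow> F y = G y"
  shows "dir_deriv v F x = dir_deriv v G x"
proof -
  have "(F has_derivative D) (at x) \<longleftrightarrow> (G has_derivative D) (at x)" for D
    using has_derivative_transform_within_open[OF _ assms(1,2)] assms(3) by metis
  then show ?thesis unfolding dir_deriv_def frechet_derivative_def by simp
qed

lemma Ck_on_cong:
  fixes F G :: "'a::euclidean_space \<Rightarrow> real"
  assumes "open U" "\<And>y. y \<in> U \<Longrightarrow> F y = G y" "Ck_on k U F"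
  shows "Ck_on k U G"
  using assms(2,3)
proof (induction k arbitrary: F G)
  case 0
  then show ?case using continuous_on_cong[of U U F G] by simp
next
  case (Suc k)
  have "Ck_on k U (dir_deriv v G)" for v
  proof (rule Suc.IH)
    show "dir_deriv v F y = dir_deriv v G y" if "y \<in> U" for y
      using dir_deriv_cong[OF assms(1) that] Suc.prems(1) by blast
    show "Ck_on k U (dir_deriv v F)" using Suc.prems(2) by (simp add: dir_deriv_def[abs_def])
  qed
  moreover have "G differentiable_on U"
    using Suc.prems by (metis Ck_on.simps(2) differentiable_on_def differentiable_transform_within
      zero_less_one)
  ultimately show ?case by (simp add: dir_deriv_def[abs_def])
qed

lemma Ck_on_add:
  fixes F G :: "'a::euclidean_space \<Rightarrow> real"
  assumes "open U" "Ck_on k U F" "Ck_on k U G"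
  shows "Ck_on k U (\<lambda>x. F x + G x)"
  using assms(2,3)
proof (induction k arbitrary: F G)
  case 0
  then show ?case by (simp add: continuous_on_add)
next
  case (Suc k)
  have "Ck_on k U (dir_deriv v (\<lambda>x. F x + G x))" for v
  proof (rule Ck_on_cong[OF assms(1)])
    show "Ck_on k U (\<lambda>x. dir_deriv v F x + dir_deriv v G x)"
      using Suc.prems by (intro Suc.IH) (simp_all add: dir_deriv_def[abs_def])
    fix x assume "x \<in> U"
    then have "F differentiable at x" "G differentiable at x"
      using Suc.prems assms(1) by (simp_all add: differentiable_on_eq_differentiable_at)
    then have "((\<lambda>x. F x + G x) has_derivative
        (\<lambda>v. dir_deriv v F x + dir_deriv v G x)) (at x)"
      unfolding dir_deriv_def frechet_derivative_works by (rule has_derivative_add)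
    then show "dir_deriv v F x + dir_deriv v G x = dir_deriv v (\<lambda>x. F x + G x) x"
      by (simp add: dir_deriv_eqI)
  qed
  then show ?case using Suc.prems by (simp add: dir_deriv_def[abs_def] differentiable_on_add)
qed

lemma has_real_derivative_along_line:
  assumes "smooth_on U F" "open U" "c + s *\<^sub>R u \<in> U"
  shows "((\<lambda>s. F (c + s *\<^sub>R u)) has_real_derivative dir_deriv u F (c + s *\<^sub>R u)) (at s)"
proof -
  have D: "(F has_derivative (\<lambda>v. dir_deriv v F (c + s *\<^sub>R u))) (at (c + s *\<^sub>R u))"
    using smooth_on_has_derivative[OF assms] .
  have "((\<lambda>s. c + s *\<^sub>R u) has_derivative (\<lambda>h. h *\<^sub>R u)) (at s)"
    by (auto intro!: derivative_eq_intros)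
  from has_derivative_compose[OF this D]
  have "((\<lambda>s. F (c + s *\<^sub>R u)) has_derivative (\<lambda>h. dir_deriv (h *\<^sub>R u) F (c + s *\<^sub>R u))) (at s)" .
  moreover have "dir_deriv (h *\<^sub>R u) F (c + s *\<^sub>R u) = h * dir_deriv u F (c + s *\<^sub>R u)" for h
    using linear_cmul[OF has_derivative_linear[OF D]] by simp
  ultimately have "((\<lambda>s. F (c + s *\<^sub>R u)) has_derivative (\<lambda>h. h * dir_deriv u F (c + s *\<^sub>R u))) (at s)"
    by simp
  then show ?thesis by (rule has_derivative_imp_has_field_derivative) simp
qed

text \<open>
  The mean value theorem is applied to \<open>s \<mapsto> F(x + s u + t v) - F(x + s u)\<close> and then to
  \<open>s \<mapsto> \<partial>\<^sub>u F(x + \<xi> u + s v)\<close>.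
\<close>

lemma second_difference_mvt:
  assumes F: "smooth_on U F" and U: "open U" and t: "t > 0"
    and sub: "\<And>\<xi> \<eta>. 0 \<le> \<xi> \<Longrightarrow> \<xi> \<le> t \<Longrightarrow> 0 \<le> \<eta> \<Longrightarrow> \<eta> \<le> t \<Longrightarrow> x + \<xi> *\<^sub>R u + \<eta> *\<^sub>R v \<in> U"
  obtains \<xi> \<eta> where "0 \<le> \<xi>" "\<xi> \<le> t" "0 \<le> \<eta>" "\<eta> \<le> t"
    "F (x + t *\<^sub>R u + t *\<^sub>R v) - F (x + t *\<^sub>R u) - F (x + t *\<^sub>R v) + F x =
       t * t * dir_deriv v (dir_deriv u F) (x + \<xi> *\<^sub>R u + \<eta> *\<^sub>R v)"
proof -
  let ?g = "\<lambda>s. F ((x + t *\<^sub>R v) + s *\<^sub>R u) - F (x + s *\<^sub>R u)"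
  let ?g' = "\<lambda>s. dir_deriv u F ((x + t *\<^sub>R v) + s *\<^sub>R u) - dir_deriv u F (x + s *\<^sub>R u)"
  have "DERIV ?g s :> ?g' s" if "0 \<le> s" "s \<le> t" for s
    using sub[OF that, of t] sub[OF that, of 0] t
    by (intro DERIV_diff has_real_derivative_along_line[OF F U]) (auto simp: algebra_simps)
  then obtain \<xi> where \<xi>: "0 < \<xi>" "\<xi> < t" "?g t - ?g 0 = (t - 0) * ?g' \<xi>"
    using MVT2[OF t, of ?g ?g'] by auto
  let ?k = "\<lambda>s. dir_deriv u F ((x + \<xi> *\<^sub>R u) + s *\<^sub>R v)"
  let ?k' = "\<lambda>s. dir_deriv v (dir_deriv u F) ((x + \<xi> *\<^sub>R u) + s *\<^sub>R v)"
  have "DERIV ?k s :> ?k' s" if "0 \<le> s" "s \<le> t" for s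
    using sub[of \<xi> s] that \<xi>
    by (intro has_real_derivative_along_line[OF smooth_on_dir_deriv[OF F] U]) auto
  then obtain \<eta> where \<eta>: "0 < \<eta>" "\<eta> < t" "?k t - ?k 0 = (t - 0) * ?k' \<eta>"
    using MVT2[OF t, of ?k ?k'] by auto
  have "?g' \<xi> = t * ?k' \<eta>" using \<eta>(3) by (simp add: algebra_simps)
  then have "?g t - ?g 0 = t * t * ?k' \<eta>" using \<xi>(3) by simp
  then show thesis using \<xi> \<eta> by (intro that[of \<xi> \<eta>]) (auto simp: algebra_simps)
qed

text \<open>
  The second difference of \<open>F\<close> is symmetric in \<open>u\<close> and \<open>v\<close>; divided by \<open>t\<^sup>2\<close> it is, by
  \<open>second_difference_mvt\<close>, close to either of the mixed derivatives for small \<open>t\<close>.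
\<close>

lemma dir_deriv_commute:
  assumes F: "smooth_on U F" and U: "open U" and x: "x \<in> U"
  shows "dir_deriv u (dir_deriv v F) x = dir_deriv v (dir_deriv u F) x" (is "?a = ?b")
proof (rule ccontr)
  assume "?a \<noteq> ?b"
  define e where "e = \<bar>?a - ?b\<bar> / 2"
  have e: "e > 0" using \<open>?a \<noteq> ?b\<close> by (simp add: e_def)
  have near: "\<exists>d>0. \<forall>y\<in>ball x d. \<bar>G y - G x\<bar> < e" if "smooth_on U G" for G
  proof -
    have "continuous (at x) G"
      using smooth_on_continuous[OF that] U x by (simp add: continuous_on_eq_continuous_at)
    then show ?thesis using e unfolding continuous_at_eps_delta
      by (metis dist_commute dist_real_def mem_ball)
  qed
  obtain d1 where d1: "d1 > 0" "\<forall>y\<in>ball x d1. \<bar>dir_deriv u (dir_deriv v F) y - ?a\<bar> < e"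
    using near[OF smooth_on_dir_deriv[OF smooth_on_dir_deriv[OF F]]] by blast
  obtain d2 where d2: "d2 > 0" "\<forall>y\<in>ball x d2. \<bar>dir_deriv v (dir_deriv u F) y - ?b\<bar> < e"
    using near[OF smooth_on_dir_deriv[OF smooth_on_dir_deriv[OF F]]] by blast
  obtain d3 where d3: "d3 > 0" "ball x d3 \<subseteq> U" using U x openE by blast
  define d where "d = min d1 (min d2 d3)"
  \<comment> \<open>small enough for the parallelogram spanned by \<open>t u\<close> and \<open>t v\<close> at \<open>x\<close> to lie in the ball of radius \<open>d\<close>\<close>
  define t where "t = d / (2 * (norm u + norm v + 1))"
  have pos: "norm u + norm v + 1 > 0" by (simp add: add_nonneg_pos)
  have d: "d > 0" using d1 d2 d3 by (simp add: d_def)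
  then have t: "t > 0" using pos by (simp add: t_def)
  have near_x: "x + \<xi> *\<^sub>R u + \<eta> *\<^sub>R v \<in> ball x d" if "0 \<le> \<xi>" "\<xi> \<le> t" "0 \<le> \<eta>" "\<eta> \<le> t" for \<xi> \<eta>
  proof -
    have "norm (\<xi> *\<^sub>R u + \<eta> *\<^sub>R v) \<le> \<xi> * norm u + \<eta> * norm v"
      using norm_triangle_ineq[of "\<xi> *\<^sub>R u" "\<eta> *\<^sub>R v"] that by simp
    also have "\<dots> \<le> t * norm u + t * norm v" using that by (intro add_mono mult_right_mono) auto
    also have "\<dots> \<le> t * (norm u + norm v + 1)" using t by (simp add: algebra_simps)
    also have "\<dots> = d / 2" unfolding t_def using pos by (simp only: times_divide_eq_left) (simp add: divide_simps)
    also have "\<dots> < d" using d by simp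
    finally have "norm (\<xi> *\<^sub>R u + \<eta> *\<^sub>R v) < d" .
    moreover have "dist x (x + \<xi> *\<^sub>R u + \<eta> *\<^sub>R v) = norm (\<xi> *\<^sub>R u + \<eta> *\<^sub>R v)"
      by (metis add.assoc add_diff_cancel_left' dist_commute dist_norm)
    ultimately show ?thesis by simp
  qed
  have inU: "y \<in> U" "y \<in> ball x d1" "y \<in> ball x d2" if "y \<in> ball x d" for y
    using that d3 by (auto simp: d_def)
  obtain \<xi> \<eta> where 1: "0 \<le> \<xi>" "\<xi> \<le> t" "0 \<le> \<eta>" "\<eta> \<le> t"
    "F (x + t *\<^sub>R u + t *\<^sub>R v) - F (x + t *\<^sub>R u) - F (x + t *\<^sub>R v) + F x =
       t * t * dir_deriv v (dir_deriv u F) (x + \<xi> *\<^sub>R u + \<eta> *\<^sub>R v)"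
    using second_difference_mvt[OF F U t, of x u v] near_x inU(1) by metis
  have sw: "x + a *\<^sub>R v + b *\<^sub>R u = x + b *\<^sub>R u + a *\<^sub>R v" for a b by simp
  obtain \<xi>' \<eta>' where 2: "0 \<le> \<xi>'" "\<xi>' \<le> t" "0 \<le> \<eta>'" "\<eta>' \<le> t"
    "F (x + t *\<^sub>R v + t *\<^sub>R u) - F (x + t *\<^sub>R v) - F (x + t *\<^sub>R u) + F x =
       t * t * dir_deriv u (dir_deriv v F) (x + \<xi>' *\<^sub>R v + \<eta>' *\<^sub>R u)"
    using second_difference_mvt[OF F U t, of x v u] near_x inU(1) unfolding sw by metis
  have "dir_deriv v (dir_deriv u F) (x + \<xi> *\<^sub>R u + \<eta> *\<^sub>R v) =
      dir_deriv u (dir_deriv v F) (x + \<eta>' *\<^sub>R u + \<xi>' *\<^sub>R v)" (is "?r = ?s")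
  proof -
    have "t * t * ?r = t * t * ?s" using 1(5) 2(5) unfolding sw by linarith
    then show ?thesis using t by simp
  qed
  moreover have "\<bar>?r - ?b\<bar> < e" using d2(2) inU(3)[OF near_x[OF 1(1-4)]] by blast
  moreover have "\<bar>?s - ?a\<bar> < e" using d1(2) inU(2)[OF near_x[OF 2(3,4,1,2)]] by blast
  ultimately have "\<bar>?a - ?b\<bar> < 2 * e" by linarith
  then show False by (simp add: e_def)
qed

lemma linear_dir_deriv:
  assumes "smooth_on U F" "open U" "x \<in> U"
  shows "linear (\<lambda>v. dir_deriv v F x)"
  using has_derivative_linear[OF smooth_on_has_derivative[OF assms]] .

lemma linear_dir_deriv_dir_deriv:
  assumes "smooth_on U F" "open U" "x \<in> U"
  shows "linear (\<lambda>v. dir_deriv w (dir_deriv v F) x)"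
  using linear_dir_deriv[OF smooth_on_dir_deriv[OF assms(1)] assms(2,3)]
  by (simp add: dir_deriv_commute[OF assms, of w])

lemma linear_basis_sum:
  fixes \<phi> :: "'a::euclidean_space \<Rightarrow> real"
  assumes "linear \<phi>" shows "(\<Sum>b\<in>Basis. (v \<bullet> b) * \<phi> b) = \<phi> v"
proof -
  have "\<phi> (\<Sum>b\<in>Basis. (v \<bullet> b) *\<^sub>R b) = (\<Sum>b\<in>Basis. (v \<bullet> b) * \<phi> b)"
    by (simp add: linear_sum[OF assms] linear_cmul[OF assms])
  then show ?thesis by (simp add: euclidean_representation)
qed

lemma linear_basis_sum_inner:
  fixes \<phi> :: "'a::euclidean_space \<Rightarrow> real"
  assumes "linear \<phi>" shows "(\<Sum>b\<in>Basis. \<phi> b *\<^sub>R b) \<bullet> v = \<phi> v"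
proof -
  have "(\<Sum>b\<in>Basis. \<phi> b *\<^sub>R b) \<bullet> v = (\<Sum>b\<in>Basis. \<phi> b * (b \<bullet> v))"
    by (simp only: inner_sum_left inner_scaleR_left)
  also have "\<dots> = (\<Sum>b\<in>Basis. (v \<bullet> b) * \<phi> b)"
    by (intro sum.cong refl) (simp add: inner_commute mult.commute)
  finally show ?thesis by (simp only: linear_basis_sum[OF assms])
qed

section \<open>Derivatives along linear vector fields\<close>

definition lin_deriv :: "('a::euclidean_space \<Rightarrow> 'a) \<Rightarrow> ('a \<Rightarrow> real) \<Rightarrow> 'a \<Rightarrow> real"
  where "lin_deriv A F x = dir_deriv (A x) F x"

lemma lin_deriv_cong:
  assumes "open U" "x \<in> U" "\<And>y. y \<in> U \<Longrightarrow> F y = G y"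
  shows "lin_deriv A F x = lin_deriv A G x"
  unfolding lin_deriv_def by (rule dir_deriv_cong[OF assms(1,2)]) (rule assms(3))

text \<open>
  In coordinates \<open>L\<^sub>A F (x) = \<Sum>\<^sub>b \<langle>A x, b\<rangle> \<partial>\<^sub>b F (x)\<close>. Differentiating the coefficients gives \<open>\<partial>\<^sub>A\<^sub>v F\<close>, and
  the symmetry of second derivatives turns the rest into \<open>L\<^sub>A (\<partial>\<^sub>v F)\<close>: the commutator of \<open>\<partial>\<^sub>v\<close> with
  \<open>L\<^sub>A\<close> is \<open>\<partial>\<^sub>A\<^sub>v\<close>.
\<close>

lemma has_derivative_lin_deriv:
  assumes F: "smooth_on U F" and U: "open U" and x: "x \<in> U" and A: "linear A"
  shows "(lin_deriv A F has_derivative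
    (\<lambda>v. dir_deriv (A v) F x + lin_deriv A (dir_deriv v F) x)) (at x)"
proof (rule has_derivative_transform_within_open[OF _ U x])
  have bA: "(A has_derivative A) (at x)"
    using A by (simp add: bounded_linear_imp_has_derivative linear_conv_bounded_linear)
  note Db = smooth_on_has_derivative[OF smooth_on_dir_deriv[OF F] U x]
  have "((\<lambda>y. \<Sum>b\<in>Basis. (A y \<bullet> b) * dir_deriv b F y) has_derivative
     (\<lambda>v. \<Sum>b\<in>Basis. (A x \<bullet> b) * dir_deriv v (dir_deriv b F) x + (A v \<bullet> b) * dir_deriv b F x)) (at x)"
    by (intro has_derivative_sum has_derivative_mult has_derivative_inner_left bA Db)
  moreover have "(\<Sum>b\<in>Basis. (A x \<bullet> b) * dir_deriv v (dir_deriv b F) x + (A v \<bullet> b) * dir_deriv b F x)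
      = dir_deriv (A v) F x + lin_deriv A (dir_deriv v F) x" for v
    using linear_basis_sum[OF linear_dir_deriv[OF F U x], of "A v"]
      linear_basis_sum[OF linear_dir_deriv_dir_deriv[OF F U x, of v], of "A x"]
    by (simp add: sum.distrib lin_deriv_def dir_deriv_commute[OF F U x, of v "A x"])
  ultimately show "((\<lambda>y. \<Sum>b\<in>Basis. (A y \<bullet> b) * dir_deriv b F y) has_derivative
     (\<lambda>v. dir_deriv (A v) F x + lin_deriv A (dir_deriv v F) x)) (at x)"
    by simp
  show "(\<Sum>b\<in>Basis. (A y \<bullet> b) * dir_deriv b F y) = lin_deriv A F y" if "y \<in> U" for y
    using linear_basis_sum[OF linear_dir_deriv[OF F U that]] by (simp add: lin_deriv_def)
qed

lemma dir_deriv_lin_deriv: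
  assumes "smooth_on U F" "open U" "x \<in> U" "linear A"
  shows "dir_deriv v (lin_deriv A F) x = dir_deriv (A v) F x + lin_deriv A (dir_deriv v F) x"
  using dir_deriv_eqI[OF has_derivative_lin_deriv[OF assms]] .

text \<open>
  The directional derivatives of \<open>L\<^sub>A F\<close> are, by \<open>has_derivative_lin_deriv\<close>, again built from functions of
  this form and derivatives of \<open>F\<close>, which makes an induction on the order of differentiability work.
\<close>

lemma smooth_on_lin_deriv:
  assumes F: "smooth_on U F" and U: "open U" and A: "linear A"
  shows "smooth_on U (lin_deriv A F)"
  unfolding smooth_on_def
proof
  fix k show "Ck_on k U (lin_deriv A F)"
    using F
  proof (induction k arbitrary: F)
    case 0
    have "continuous (at x) (lin_deriv A F)" if "x \<in> U" for x
      using has_derivative_continuous[OF has_derivative_lin_deriv[OF 0 U that A]] .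
    then show ?case by (simp add: continuous_at_imp_continuous_on)
  next
    case (Suc k)
    have "lin_deriv A F differentiable_on U"
      using has_derivative_lin_deriv[OF Suc.prems U _ A] U
      by (auto simp: differentiable_on_eq_differentiable_at differentiable_def)
    moreover have "Ck_on k U (dir_deriv v (lin_deriv A F))" for v
    proof (rule Ck_on_cong[OF U])
      show "Ck_on k U (\<lambda>x. dir_deriv (A v) F x + lin_deriv A (dir_deriv v F) x)"
        using Suc.IH[OF smooth_on_dir_deriv[OF Suc.prems]] smooth_on_dir_deriv[OF Suc.prems]
        by (intro Ck_on_add[OF U]) (auto simp: smooth_on_def)
      show "dir_deriv (A v) F x + lin_deriv A (dir_deriv v F) x = dir_deriv v (lin_deriv A F) x"
        if "x \<in> U" for x using dir_deriv_lin_deriv[OF Suc.prems U that A] by simp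
    qed
    ultimately show ?case by (simp add: dir_deriv_def[abs_def])
  qed
qed

abbreviation euler :: "('a::euclidean_space \<Rightarrow> real) \<Rightarrow> 'a \<Rightarrow> real"
  where "euler \<equiv> lin_deriv (\<lambda>x. x)"

definition flat_laplacian :: "('a::euclidean_space \<Rightarrow> real) \<Rightarrow> 'a \<Rightarrow> real"
  where "flat_laplacian F x = (\<Sum>b\<in>Basis. dir_deriv b (dir_deriv b F) x)"

text \<open>
  Both sides equal \<open>\<partial>\<^sub>A\<^sub>x F (x) + D\<^sup>2F(x)(x, A x)\<close>; the linear fields \<open>A x\<close> and \<open>x\<close> commute.
\<close>

lemma lin_deriv_euler_commute:
  assumes F: "smooth_on U F" and U: "open U" and x: "x \<in> U" and A: "linear A"
  shows "euler (lin_deriv A F) x = lin_deriv A (euler F) x"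
  using dir_deriv_lin_deriv[OF F U x A, of x] dir_deriv_lin_deriv[OF F U x linear_ident, of "A x"]
    dir_deriv_commute[OF F U x, of "A x" x]
  by (simp add: lin_deriv_def)

lemma sum_skew_symmetric_eq_0:
  fixes A :: "'a::euclidean_space \<Rightarrow> 'a"
  assumes skew: "\<And>x y. A x \<bullet> y = - (A y \<bullet> x)" and sym: "\<And>v w. H v w = H w v"
    and lin: "\<And>v. linear (H v)"
  shows "(\<Sum>b\<in>Basis. H b (A b)) = (0::real)"
proof -
  have e: "(\<Sum>b\<in>Basis. H b (A b)) = (\<Sum>b\<in>Basis. \<Sum>c\<in>Basis. (A b \<bullet> c) * H b c)"
    using linear_basis_sum[OF lin] by simp
  also have "\<dots> = (\<Sum>b\<in>Basis. \<Sum>c\<in>Basis. (A c \<bullet> b) * H c b)" by (rule sum.swap)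
  also have "\<dots> = - (\<Sum>b\<in>Basis. \<Sum>c\<in>Basis. (A b \<bullet> c) * H b c)"
    unfolding sum_negf[symmetric]
  proof (intro sum.cong refl)
    fix b c show "(A c \<bullet> b) * H c b = - ((A b \<bullet> c) * H b c)"
      using skew[of c b] sym[of c b] by simp
  qed
  finally show ?thesis using e by simp
qed

text \<open>
  Commuting \<open>\<partial>\<^sub>b\<close> past \<open>L\<^sub>A\<close> twice leaves \<open>2 \<Sum>\<^sub>b \<partial>\<^sub>b \<partial>\<^sub>A\<^sub>b F\<close>, the pairing of the symmetric Hessian
  with the skew \<open>A\<close>.
\<close>

lemma lin_deriv_flat_laplacian_commute:
  assumes F: "smooth_on U F" and U: "open U" and x: "x \<in> U" and A: "linear A"
    and skew: "\<And>x y. A x \<bullet> y = - (A y \<bullet> x)"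
  shows "flat_laplacian (lin_deriv A F) x = lin_deriv A (flat_laplacian F) x"
proof -
  let ?H = "\<lambda>v w. dir_deriv v (dir_deriv w F) x"
  have "dir_deriv b (dir_deriv b (lin_deriv A F)) x =
      2 * ?H b (A b) + lin_deriv A (dir_deriv b (dir_deriv b F)) x" for b
  proof -
    have "dir_deriv b (dir_deriv b (lin_deriv A F)) x =
        dir_deriv b (\<lambda>y. dir_deriv (A b) F y + lin_deriv A (dir_deriv b F) y) x"
      by (rule dir_deriv_cong[OF U x]) (rule dir_deriv_lin_deriv[OF F U _ A])
    also have "\<dots> = ?H b (A b) + dir_deriv b (lin_deriv A (dir_deriv b F)) x"
      by (intro dir_deriv_eqI[OF has_derivative_add] smooth_on_has_derivative[OF _ U x]
        smooth_on_lin_deriv[OF _ U A] smooth_on_dir_deriv F)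
    also have "\<dots> = ?H b (A b) + (?H (A b) b + lin_deriv A (dir_deriv b (dir_deriv b F)) x)"
      using dir_deriv_lin_deriv[OF smooth_on_dir_deriv[OF F] U x A] by simp
    finally show ?thesis using dir_deriv_commute[OF F U x, of b "A b"] by simp
  qed
  moreover have "(\<Sum>b\<in>Basis. ?H b (A b)) = 0"
    by (rule sum_skew_symmetric_eq_0[OF skew dir_deriv_commute[OF F U x]
      linear_dir_deriv_dir_deriv[OF F U x]])
  moreover have "lin_deriv A (flat_laplacian F) x =
      (\<Sum>b\<in>Basis. lin_deriv A (dir_deriv b (dir_deriv b F)) x)"
    unfolding flat_laplacian_def[abs_def] lin_deriv_def
    by (intro dir_deriv_eqI[OF has_derivative_sum] smooth_on_has_derivative[OF _ U x] smooth_on_dir_deriv F)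
  ultimately show ?thesis
    by (simp add: flat_laplacian_def sum.distrib flip: sum_distrib_left)
qed

section \<open>Calculus on the sphere by extension\<close>

text \<open>
  A derivative within the sphere is determined on tangent vectors, because the great circle
  through \<open>p\<close> with direction \<open>X\<close> stays in the sphere.
\<close>

lemma sphere_deriv_unique:
  fixes f :: "'a::euclidean_space \<Rightarrow> 'b::real_normed_vector"
  assumes p: "p \<in> sphere 0 1" and X: "X \<bullet> p = 0"
    and D: "(f has_derivative D) (at p within sphere 0 1)"
    and D': "(f has_derivative D') (at p within sphere 0 1)"
  shows "D X = D' X"
proof (cases "X = 0")
  case True
  then show ?thesis using D D' by (simp add: linear_0[OF has_derivative_linear])
next
  case False
  define Y where "Y = X /\<^sub>R norm X"
  have Y: "norm Y = 1" "Y \<bullet> p = 0" "p \<bullet> Y = 0" "norm p = 1"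
    using False X p by (auto simp: Y_def inner_commute)
  define c where "c = (\<lambda>t. cos t *\<^sub>R p + sin t *\<^sub>R Y)"
  have "norm (c t) = 1" for t
    unfolding norm_eq_1 c_def using Y sin_cos_squared_add3[of t]
    by (simp add: inner_add_left inner_add_right norm_eq_1)
  then have sub: "c ` UNIV \<subseteq> sphere 0 1" by auto
  have c0: "c 0 = p" by (simp add: c_def)
  have dc: "(c has_derivative (\<lambda>h. h *\<^sub>R Y)) (at 0)"
    unfolding c_def by (auto intro!: derivative_eq_intros)
  have comp: "((\<lambda>t. f (c t)) has_derivative (\<lambda>h. E (h *\<^sub>R Y))) (at 0)"
    if "(f has_derivative E) (at p within sphere 0 1)" for E
  proof -
    have "(f has_derivative E) (at (c 0) within c ` UNIV)"
      using has_derivative_subset[OF that sub] by (simp add: c0)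
    from has_derivative_in_compose[OF dc this] show ?thesis .
  qed
  have "(\<lambda>h. D (h *\<^sub>R Y)) = (\<lambda>h. D' (h *\<^sub>R Y))"
    using has_derivative_unique[OF comp[OF D] comp[OF D']] .
  then have "D (norm X *\<^sub>R Y) = D' (norm X *\<^sub>R Y)" by metis
  then show ?thesis using False by (simp add: Y_def)
qed

text \<open>
  Since \<open>\<langle>x, x\<rangle> = 1\<close> on the sphere, a multiple of \<open>\<langle>x, x\<rangle> - 1\<close> can be subtracted from \<open>f\<close> without
  changing it there. This modifies a derivative within the sphere freely on the normal line, and a
  suitable multiple makes it vanish on \<open>p\<close>, hence be given by a tangent vector.
\<close>

lemma sphere_grad_eq:
  fixes f :: "'a::euclidean_space \<Rightarrow> real"
  assumes p: "p \<in> sphere 0 1" and D: "(f has_derivative D) (at p within sphere 0 1)"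
  shows "sphere_grad f p = tangent_proj p (\<Sum>b\<in>Basis. D b *\<^sub>R b)" (is "_ = tangent_proj p ?g")
proof -
  have pp: "p \<bullet> p = 1" using p by (simp add: norm_eq_1)
  note g = linear_basis_sum_inner[OF has_derivative_linear[OF D]]
  have gp: "tangent_proj p ?g \<bullet> X = D X - D p * (p \<bullet> X)" for X
    by (simp add: tangent_proj_def inner_diff_left g)
  \<comment> \<open>the derivative of \<open>\<langle>x, x\<rangle> / 2\<close> at \<open>p\<close> is \<open>\<langle>p, \<cdot>\<rangle>\<close>, so the factor \<open>D p\<close> cancels the value on \<open>p\<close>\<close>
  have "((\<lambda>x. f x - (x \<bullet> x - 1) / 2 * D p) has_derivative (\<lambda>X. D X - D p * (p \<bullet> X)))
      (at p within sphere 0 1)"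
    by (auto intro!: derivative_eq_intros D simp: inner_commute)
  then have "(f has_derivative (\<lambda>X. D X - D p * (p \<bullet> X))) (at p within sphere 0 1)"
    by (rule has_derivative_transform[OF p, rotated]) (simp add: norm_eq_1)
  then have d: "(f has_derivative (\<lambda>X. tangent_proj p ?g \<bullet> X)) (at p within sphere 0 1)"
    by (simp only: gp)
  show ?thesis unfolding sphere_grad_def
  proof (rule the_equality)
    show "tangent_proj p ?g \<in> tangent_space p \<and>
      (f has_derivative (\<lambda>X. tangent_proj p ?g \<bullet> X)) (at p within sphere 0 1)"
      using d pp by (simp add: tangent_space_def gp)
  next
    fix h assume h: "h \<in> tangent_space p \<and> (f has_derivative (\<lambda>X. h \<bullet> X)) (at p within sphere 0 1)"
    let ?X = "h - tangent_proj p ?g"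
    have X: "?X \<bullet> p = 0" using h pp by (simp add: tangent_space_def inner_diff_left gp)
    have "h \<bullet> ?X = tangent_proj p ?g \<bullet> ?X" using sphere_deriv_unique[OF p X] h d by blast
    then have "?X \<bullet> ?X = 0" by (simp add: inner_diff_left)
    then show "h = tangent_proj p ?g" by simp
  qed
qed

lemma sphere_grad_extension:
  assumes F: "smooth_on U F" and U: "open U" "sphere 0 1 \<subseteq> U"
    and eq: "\<forall>p\<in>sphere 0 1. F p = f p" and p: "p \<in> sphere 0 1"
  shows "sphere_grad f p = (\<Sum>b\<in>Basis. dir_deriv b F p *\<^sub>R b) - euler F p *\<^sub>R p"
proof -
  have pU: "p \<in> U" using U(2) p by blast
  have "(F has_derivative (\<lambda>v. dir_deriv v F p)) (at p within sphere 0 1)"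
    by (rule has_derivative_at_withinI[OF smooth_on_has_derivative[OF F U(1) pU]])
  then have "(f has_derivative (\<lambda>v. dir_deriv v F p)) (at p within sphere 0 1)"
    by (rule has_derivative_transform[OF p, rotated]) (use eq in simp)
  moreover have "(\<Sum>b\<in>Basis. dir_deriv b F p *\<^sub>R b) \<bullet> p = euler F p"
    by (simp add: linear_basis_sum_inner[OF linear_dir_deriv[OF F U(1) pU]] lin_deriv_def)
  ultimately show ?thesis using sphere_grad_eq[OF p] by (simp add: tangent_proj_def)
qed

lemma sphere_grad_inner_extension:
  assumes F: "smooth_on U F" and U: "open U" "sphere 0 1 \<subseteq> U"
    and eq: "\<forall>p\<in>sphere 0 1. F p = f p" and p: "p \<in> sphere 0 1" and X: "X \<bullet> p = 0"
  shows "X \<bullet> sphere_grad f p = dir_deriv X F p"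
proof -
  have pU: "p \<in> U" using U(2) p by blast
  show ?thesis
    using X unfolding sphere_grad_extension[OF F U eq p] inner_commute[of X]
    by (simp add: inner_diff_left inner_commute[of p]
      linear_basis_sum_inner[OF linear_dir_deriv[OF F U(1) pU]])
qed

text \<open>
  The trace of a bilinear form on the tangent space is the full trace minus the normal part.
\<close>

lemma sum_tangent_proj_bilinear:
  fixes H :: "'a::euclidean_space \<Rightarrow> 'a \<Rightarrow> real"
  assumes l1: "\<And>w. linear (\<lambda>v. H v w)" and l2: "\<And>v. linear (H v)" and p: "p \<bullet> p = 1"
  shows "(\<Sum>b\<in>Basis. H (tangent_proj p b) (tangent_proj p b)) = (\<Sum>b\<in>Basis. H b b) - H p p"
proof -
  have "H (tangent_proj p b) (tangent_proj p b) =
      H b b - (p \<bullet> b) * H b p - (p \<bullet> b) * H p b + ((p \<bullet> b) * (p \<bullet> b)) * H p p" for b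
    unfolding tangent_proj_def linear_diff[OF l1] linear_diff[OF l2] linear_cmul[OF l1] linear_cmul[OF l2]
    by (simp add: inner_commute[of b] algebra_simps)
  then have "(\<Sum>b\<in>Basis. H (tangent_proj p b) (tangent_proj p b)) =
      (\<Sum>b\<in>Basis. H b b) - (\<Sum>b\<in>Basis. (p \<bullet> b) * H b p) - (\<Sum>b\<in>Basis. (p \<bullet> b) * H p b) +
      (\<Sum>b\<in>Basis. (p \<bullet> b) * (p \<bullet> b)) * H p p"
    by (simp add: sum.distrib sum_subtractf sum_distrib_right)
  moreover have "(\<Sum>b\<in>Basis. (p \<bullet> b) * (p \<bullet> b)) = 1" using p by (simp add: euclidean_inner[of p p])
  ultimately show ?thesis using linear_basis_sum[OF l1, of p p] linear_basis_sum[OF l2, of p p] by simp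
qed

text \<open>
  In polar coordinates \<open>r\<^sup>2 \<Delta> = E\<^sup>2 + (d - 2) E + \<Delta>\<^sub>S\<close> with \<open>d\<close> the dimension of the ambient space and
  \<open>\<Delta>\<^sub>S\<close> the Laplacian of the unit sphere. The definition solves this for \<open>\<Delta>\<^sub>S\<close> at \<open>r = 1\<close>; the factor
  \<open>r\<^sup>2\<close> is dropped since only values and tangential derivatives on the unit sphere matter.
\<close>

definition extended_laplacian :: "('a::euclidean_space \<Rightarrow> real) \<Rightarrow> 'a \<Rightarrow> real"
  where "extended_laplacian F x =
    flat_laplacian F x - euler (euler F) x - (real DIM('a) - 2) * euler F x"

text \<open>
  The gradient field extends to \<open>x \<mapsto> grad F (x) - E F (x) x\<close>. Its derivative in a tangent direction \<open>X\<close>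
  has the tangential part of \<open>D\<^sup>2F(X, \<cdot>) - E F (p) X\<close>, whose trace over the tangent space is
  \<open>\<Delta>F - D\<^sup>2F(p, p) - (d - 1) E F\<close>, where \<open>d\<close> is the ambient dimension. Finally \<open>D\<^sup>2F(p, p) = E(E F) - E F\<close>.
\<close>

lemma sphere_laplacian_extension:
  fixes f :: "'a::euclidean_space \<Rightarrow> real"
  assumes F: "smooth_on U F" and U: "open U" "sphere 0 1 \<subseteq> U"
    and eq: "\<forall>p\<in>sphere 0 1. F p = f p" and p: "p \<in> sphere 0 1"
  shows "sphere_laplacian f p = extended_laplacian F p"
proof -
  have pU: "p \<in> U" using U(2) p by blast
  have pp: "p \<bullet> p = 1" using p by (simp add: norm_eq_1)
  let ?H = "\<lambda>v w. dir_deriv v (dir_deriv w F) p"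
  let ?G = "\<lambda>x. (\<Sum>b\<in>Basis. dir_deriv b F x *\<^sub>R b) - euler F x *\<^sub>R x"
  let ?D = "\<lambda>X. (\<Sum>b\<in>Basis. ?H X b *\<^sub>R b) - (euler F p *\<^sub>R X + dir_deriv X (euler F) p *\<^sub>R p)"
  have "(?G has_derivative ?D) (at p)"
    by (intro has_derivative_diff has_derivative_sum has_derivative_scaleR has_derivative_scaleR_left
      has_derivative_ident smooth_on_has_derivative[OF _ U(1) pU] smooth_on_dir_deriv[OF F]
      smooth_on_lin_deriv[OF F U(1)] linear_ident)
  then have "(?G has_derivative ?D) (at p within sphere 0 1)" by (rule has_derivative_at_withinI)
  then have D: "(sphere_grad f has_derivative ?D) (at p within sphere 0 1)"
    by (rule has_derivative_transform[OF p, rotated]) (simp add: sphere_grad_extension[OF F U eq])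
  then have D': "(sphere_grad f has_derivative
      frechet_derivative (sphere_grad f) (at p within sphere 0 1)) (at p within sphere 0 1)"
    unfolding frechet_derivative_works[symmetric] differentiable_def by blast
  have lin: "linear (\<lambda>v. ?H v w)" "linear (?H v)" for v w
    using linear_dir_deriv[OF smooth_on_dir_deriv[OF F] U(1) pU]
      linear_dir_deriv_dir_deriv[OF F U(1) pU] by auto
  have proj: "tangent_proj p x \<bullet> b = x \<bullet> tangent_proj p b" for x b
    by (simp add: tangent_proj_def inner_diff_left inner_diff_right inner_commute)
  have cov: "sphere_cov_deriv (sphere_grad f) p (tangent_proj p b) \<bullet> b =
      ?H (tangent_proj p b) (tangent_proj p b) - euler F p * (1 - (p \<bullet> b) * (p \<bullet> b))"
    if b: "b \<in> Basis" for b
  proof -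
    let ?X = "tangent_proj p b"
    have X: "?X \<bullet> p = 0" using pp by (simp add: tangent_proj_def inner_diff_left)
    have "sphere_cov_deriv (sphere_grad f) p ?X \<bullet> b = ?D ?X \<bullet> ?X"
      unfolding sphere_cov_deriv_def sphere_deriv_unique[OF p X D' D] by (rule proj)
    also have "\<dots> = ?H ?X ?X - euler F p * (?X \<bullet> ?X)"
      unfolding inner_diff_left inner_add_left inner_scaleR_left linear_basis_sum_inner[OF lin(2)]
      using X by (simp add: inner_commute[of p])
    also have "?X \<bullet> ?X = 1 - (p \<bullet> b) * (p \<bullet> b)"
      using b pp by (simp add: tangent_proj_def inner_diff_left inner_diff_right inner_commute)
    finally show ?thesis .
  qed
  have "sphere_laplacian f p =
      (\<Sum>b\<in>Basis. ?H (tangent_proj p b) (tangent_proj p b)) -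
      euler F p * (\<Sum>b\<in>Basis. 1 - (p \<bullet> b) * (p \<bullet> b))"
    unfolding sphere_laplacian_def sphere_div_def sum_distrib_left sum_subtractf[symmetric]
    by (intro sum.cong refl cov)
  also have "(\<Sum>b\<in>Basis. 1 - (p \<bullet> b) * (p \<bullet> b)) = real DIM('a) - 1"
    using pp by (simp add: sum_subtractf euclidean_inner[of p p])
  also have "(\<Sum>b\<in>Basis. ?H (tangent_proj p b) (tangent_proj p b)) = flat_laplacian F p - ?H p p"
    using sum_tangent_proj_bilinear[of ?H, OF lin pp] by (simp add: flat_laplacian_def)
  also have "?H p p = euler (euler F) p - euler F p"
    using dir_deriv_lin_deriv[OF F U(1) pU linear_ident, of p] by (simp add: lin_deriv_def)
  finally show ?thesis by (simp add: extended_laplacian_def algebra_simps)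
qed

lemma lin_deriv_extended_laplacian:
  fixes F :: "'a::euclidean_space \<Rightarrow> real"
  assumes F: "smooth_on U F" and U: "open U" and x: "x \<in> U" and A: "linear A"
    and skew: "\<And>x y. A x \<bullet> y = - (A y \<bullet> x)"
  shows "extended_laplacian (lin_deriv A F) x = lin_deriv A (extended_laplacian F) x"
    and "\<exists>D. (extended_laplacian F has_derivative D) (at x)"
proof -
  note sm = smooth_on_lin_deriv[OF _ U linear_ident]
  note diff = smooth_on_has_derivative[OF _ U x]
  have flat: "(flat_laplacian F has_derivative
      (\<lambda>v. \<Sum>b\<in>Basis. dir_deriv v (dir_deriv b (dir_deriv b F)) x)) (at x)"
    unfolding flat_laplacian_def[abs_def]
    by (intro has_derivative_sum diff smooth_on_dir_deriv F)
  have D: "(extended_laplacian F has_derivative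
      (\<lambda>v. (\<Sum>b\<in>Basis. dir_deriv v (dir_deriv b (dir_deriv b F)) x) - dir_deriv v (euler (euler F)) x
        - (real DIM('a) - 2) * dir_deriv v (euler F) x)) (at x)"
    unfolding extended_laplacian_def[abs_def]
    by (intro has_derivative_diff has_derivative_mult_right flat diff sm F)
  then show "\<exists>D. (extended_laplacian F has_derivative D) (at x)" by blast
  have "euler (euler (lin_deriv A F)) x = euler (lin_deriv A (euler F)) x"
    by (rule lin_deriv_cong[OF U x]) (rule lin_deriv_euler_commute[OF F U _ A])
  also have "\<dots> = lin_deriv A (euler (euler F)) x"
    by (rule lin_deriv_euler_commute[OF sm[OF F] U x A])
  finally show "extended_laplacian (lin_deriv A F) x = lin_deriv A (extended_laplacian F) x"
    using lin_deriv_flat_laplacian_commute[OF F U x A skew] lin_deriv_euler_commute[OF F U x A]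
      dir_deriv_eqI[OF flat, of "A x"] dir_deriv_eqI[OF D, of "A x"]
    by (simp add: extended_laplacian_def lin_deriv_def)
qed

text \<open>
  The function \<open>extended_laplacian F + \<mu> F\<close> vanishes on the sphere, and therefore its derivative in
  the tangent direction \<open>A p\<close> vanishes too. As \<open>L\<^sub>A\<close> commutes with \<^const>\<open>extended_laplacian\<close>, this is the
  eigenvalue equation for \<open>L\<^sub>A F\<close>.
\<close>

lemma eigenspace_lin_deriv:
  fixes F :: "'a::euclidean_space \<Rightarrow> real"
  assumes F: "smooth_on U F" and U: "open U" "sphere 0 1 \<subseteq> U"
    and eq: "\<forall>p\<in>sphere 0 1. F p = f p"
    and f: "f \<in> sphere_eigenspace \<mu>"
    and A: "linear A" and skew: "\<And>x y. A x \<bullet> y = - (A y \<bullet> x)"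
    and h: "\<forall>p\<in>sphere 0 1. lin_deriv A F p = h p"
  shows "h \<in> sphere_eigenspace \<mu>"
proof -
  let ?H = "lin_deriv A F"
  have sm: "smooth_on U ?H" by (rule smooth_on_lin_deriv[OF F U(1) A])
  have "smooth_on_sphere h"
    using sm U h unfolding smooth_on_sphere_def smooth_on_def by (intro exI[of _ U] exI[of _ ?H]) simp
  moreover have "sphere_laplacian h p + \<mu> * h p = 0" if p: "p \<in> sphere 0 1" for p
  proof -
    have pU: "p \<in> U" using U(2) p by blast
    have "A p \<bullet> p = 0" using skew[of p p] by simp
    let ?E = "\<lambda>x. extended_laplacian F x + \<mu> * F x"
    obtain D where D: "(extended_laplacian F has_derivative D) (at p)"
      using lin_deriv_extended_laplacian(2)[OF F U(1) pU A skew] by blast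
    have "(?E has_derivative (\<lambda>v. D v + \<mu> * dir_deriv v F p)) (at p)"
      by (intro has_derivative_add has_derivative_mult_right D smooth_on_has_derivative[OF F U(1) pU])
    then have E: "(?E has_derivative (\<lambda>v. D v + \<mu> * dir_deriv v F p)) (at p within sphere 0 1)"
      by (rule has_derivative_at_withinI)
    have "?E x = 0" if x: "x \<in> sphere 0 1" for x
    proof -
      have "sphere_laplacian f x + \<mu> * f x = 0" using f x unfolding sphere_eigenspace_def by blast
      moreover have "F x = f x" using eq x by blast
      ultimately show ?thesis using sphere_laplacian_extension[OF F U eq x] by simp
    qed
    then have "(?E has_derivative (\<lambda>v. 0)) (at p within sphere 0 1)"
      by (intro has_derivative_transform[OF p _ has_derivative_const[of 0]]) auto
    from sphere_deriv_unique[OF p \<open>A p \<bullet> p = 0\<close> E this]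
    have "D (A p) + \<mu> * ?H p = 0" by (simp add: lin_deriv_def)
    moreover have "sphere_laplacian h p = D (A p)"
      using sphere_laplacian_extension[OF sm U h p] dir_deriv_eqI[OF D, of "A p"]
        lin_deriv_extended_laplacian(1)[OF F U(1) pU A skew] by (simp add: lin_deriv_def[of A "extended_laplacian F"])
    ultimately show ?thesis using h p by simp
  qed
  ultimately show ?thesis by (simp add: sphere_eigenspace_def)
qed

section \<open>The surface measure\<close>

lemma space_sphere_measure: "space (sphere_measure :: 'a::euclidean_space measure) = sphere 0 1"
  by (simp add: sphere_measure_def space_scale_measure space_restrict_space)

lemma sets_sphere_measure:
  "sets (sphere_measure :: 'a::euclidean_space measure) = sets (restrict_space borel (sphere 0 1))"
  by (simp add: sphere_measure_def)

lemma measurable_radial_projection: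
  "(\<lambda>x::'a::euclidean_space. x /\<^sub>R norm x) \<in>
     measurable (restrict_space lborel (ball 0 1 - {0})) (restrict_space borel (sphere 0 1))"
proof (rule measurable_restrict_space2)
  show "(\<lambda>x::'a. x /\<^sub>R norm x) \<in> space (restrict_space lborel (ball 0 1 - {0})) \<rightarrow> sphere 0 1"
    by (auto simp: space_restrict_space)
  show "(\<lambda>x::'a. x /\<^sub>R norm x) \<in> borel_measurable (restrict_space lborel (ball 0 1 - {0}))"
    by (rule measurable_restrict_space1) simp
qed

lemma emeasure_sphere_measure:
  fixes A :: "'a::euclidean_space set"
  assumes A: "A \<in> sets sphere_measure"
  shows "emeasure sphere_measure A = ennreal (real DIM('a)) *
    emeasure lborel {x \<in> ball 0 1 - {0}. x /\<^sub>R norm x \<in> A}"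
proof -
  have A': "A \<in> sets (restrict_space borel (sphere 0 1))" using A sets_sphere_measure by blast
  have "emeasure (restrict_space lborel (ball 0 1 - {0})) ((\<lambda>x. x /\<^sub>R norm x) -` A \<inter> (ball 0 1 - {0})) =
      emeasure lborel {x \<in> ball 0 1 - {0}. x /\<^sub>R norm x \<in> A}"
    by (subst emeasure_restrict_space) (auto intro!: arg_cong[where f = "emeasure lborel"])
  then show ?thesis
    using emeasure_distr[OF measurable_radial_projection A']
    by (simp add: sphere_measure_def space_restrict_space)
qed

lemma finite_measure_sphere_measure:
  "finite_measure (sphere_measure :: 'a::euclidean_space measure)"
proof
  have "emeasure (sphere_measure :: 'a measure) (space sphere_measure) \<le>
      ennreal (real DIM('a)) * emeasure lborel (ball (0::'a) 1)"
    unfolding emeasure_sphere_measure[OF sets.top]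
    by (intro mult_left_mono emeasure_mono) auto
  also have "\<dots> < \<infinity>"
    using emeasure_lborel_ball_finite[of "0::'a" 1] by (simp add: ennreal_mult_less_top less_top)
  finally show "emeasure (sphere_measure :: 'a measure) (space sphere_measure) \<noteq> \<infinity>" by simp
qed

lemma measurable_sphere_measureI:
  fixes g :: "'a::euclidean_space \<Rightarrow> real"
  assumes "continuous_on (sphere 0 1) g" shows "g \<in> borel_measurable sphere_measure"
  using borel_measurable_continuous_on_restrict[OF assms]
  by (simp cong: measurable_cong_sets add: sets_sphere_measure)

lemma continuous_sphere_bounded:
  fixes g :: "'a::euclidean_space \<Rightarrow> real"
  assumes "continuous_on (sphere 0 1) g"
  obtains C where "\<And>x. x \<in> sphere 0 1 \<Longrightarrow> \<bar>g x\<bar> \<le> C"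
proof -
  have "bounded (g ` sphere 0 1)"
    by (intro compact_imp_bounded compact_continuous_image assms) simp
  then obtain C where "\<forall>x\<in>sphere 0 1. \<bar>g x\<bar> \<le> C" unfolding bounded_iff by auto
  then show thesis using that by blast
qed

lemma integrable_sphere_measureI:
  fixes g :: "'a::euclidean_space \<Rightarrow> real"
  assumes "continuous_on (sphere 0 1) g" shows "integrable sphere_measure g"
proof -
  interpret finite_measure "sphere_measure :: 'a measure" by (rule finite_measure_sphere_measure)
  obtain C where C: "\<And>x. x \<in> sphere 0 1 \<Longrightarrow> \<bar>g x\<bar> \<le> C"
    using continuous_sphere_bounded[OF assms] by blast
  show ?thesis
    by (rule integrable_const_bound[where B = C])
      (auto intro!: AE_I2 measurable_sphere_measureI assms simp: space_sphere_measure C)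
qed

text \<open>
  A Borel measure that agrees with Lebesgue measure on boxes is Lebesgue measure, and the
  inverse of an orthogonal map preserves the Lebesgue measure of boxes.
\<close>

lemma distr_lborel_orthogonal:
  fixes R :: "real^'n::{finite,wellorder} \<Rightarrow> real^'n::{finite,wellorder}"
  assumes R: "orthogonal_transformation R"
  shows "distr lborel borel R = lborel"
proof (rule lborel_eqI[symmetric])
  have lin: "linear R" using R by (simp add: orthogonal_transformation_def)
  then have m: "R \<in> borel_measurable borel"
    by (intro borel_measurable_continuous_onI linear_continuous_on)
      (simp add: linear_conv_bounded_linear)
  fix l u :: "(real, 'n) vec" assume lu: "\<And>b. b \<in> Basis \<Longrightarrow> l \<bullet> b \<le> u \<bullet> b"
  let ?B = "R -` box l u"
  have B: "?B = inv R ` box l u"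
    using bij_vimage_eq_inv_image[OF orthogonal_transformation_bij[OF R]] by simp
  have bs: "?B \<in> sets borel" using measurable_sets[OF m, of "box l u"] by simp
  have lm: "?B \<in> lmeasurable"
    unfolding B by (rule measurable_orthogonal_image[OF orthogonal_transformation_inv[OF R]]) simp
  have "measure lebesgue ?B = measure lebesgue (box l u)"
    unfolding B by (rule measure_orthogonal_image[OF orthogonal_transformation_inv[OF R]]) simp
  then have "emeasure lebesgue ?B = emeasure lebesgue (box l u)"
    using lm by (simp add: emeasure_eq_measure2)
  then have "emeasure lborel ?B = emeasure lborel (box l u)" using bs by simp
  then show "emeasure (distr lborel borel R) (box l u) = (\<Prod>b\<in>Basis. (u - l) \<bullet> b)"
    using emeasure_distr[of R lborel borel "box l u"] m lu by (simp add: emeasure_lborel_box)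
qed simp

text \<open>
  An orthogonal map preserves the punctured ball and commutes with the radial projection, so the
  invariance is inherited from Lebesgue measure.
\<close>

lemma distr_sphere_measure_orthogonal:
  fixes R :: "real^'n::{finite,wellorder} \<Rightarrow> real^'n::{finite,wellorder}"
  assumes R: "orthogonal_transformation R"
  shows "R \<in> measurable sphere_measure sphere_measure"
    and "distr sphere_measure sphere_measure R = sphere_measure"
proof -
  have lin: "linear R" using R by (simp add: orthogonal_transformation_def)
  then have "continuous_on UNIV R"
    by (intro linear_continuous_on) (simp add: linear_conv_bounded_linear)
  then have mb: "R \<in> borel_measurable borel" by (rule borel_measurable_continuous_onI)
  have n: "norm (R x) = norm x" for x by (rule orthogonal_transformation_norm[OF R])
  have "R \<in> measurable (restrict_space borel (sphere 0 1)) (restrict_space borel (sphere 0 1))"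
    by (intro measurable_restrict_space2 measurable_restrict_space1 mb)
      (auto simp: space_restrict_space n)
  then show m: "R \<in> measurable sphere_measure sphere_measure"
    by (simp cong: measurable_cong_sets add: sets_sphere_measure)
  show "distr sphere_measure sphere_measure R = sphere_measure"
  proof (rule measure_eqI)
    fix A assume "A \<in> sets (distr sphere_measure sphere_measure R)"
    then have A: "A \<in> sets sphere_measure" by simp
    let ?S = "{x \<in> ball 0 1 - {0}. x /\<^sub>R norm x \<in> A}"
    have pre: "R -` A \<inter> space sphere_measure \<in> sets sphere_measure"
      using measurable_sets[OF m A] .
    have "A \<in> sets (restrict_space borel (sphere 0 1))" using A sets_sphere_measure by blast
    from measurable_sets[OF measurable_radial_projection this]
    have "(\<lambda>x. x /\<^sub>R norm x) -` A \<inter> (ball 0 1 - {0}) \<in> sets (restrict_space lborel (ball 0 1 - {0}))"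
      by (simp add: space_restrict_space)
    then have "(\<lambda>x. x /\<^sub>R norm x) -` A \<inter> (ball 0 1 - {0}) \<in> sets lborel"
      by (subst (asm) sets_restrict_space_iff) auto
    moreover have "(\<lambda>x. x /\<^sub>R norm x) -` A \<inter> (ball 0 1 - {0}) = ?S" by auto
    ultimately have S: "?S \<in> sets borel" by simp
    have "{x \<in> ball 0 1 - {0}. x /\<^sub>R norm x \<in> R -` A \<inter> space sphere_measure} = R -` ?S"
    proof -
      have "R (x /\<^sub>R norm x) = R x /\<^sub>R norm x" for x by (rule linear_cmul[OF lin])
      moreover have "R x = 0 \<longleftrightarrow> x = 0" for x using n by (metis norm_eq_zero)
      ultimately show ?thesis by (auto simp: n space_sphere_measure)
    qed
    then have "emeasure lborel {x \<in> ball 0 1 - {0}. x /\<^sub>R norm x \<in> R -` A \<inter> space sphere_measure} =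
        emeasure (distr lborel borel R) ?S"
      using emeasure_distr[of R lborel borel ?S] mb S by simp
    then show "emeasure (distr sphere_measure sphere_measure R) A = emeasure sphere_measure A"
      using emeasure_distr[OF m A] emeasure_sphere_measure[OF pre] emeasure_sphere_measure[OF A]
      by (simp add: distr_lborel_orthogonal[OF R])
  qed simp
qed

lemma integral_sphere_measure_orthogonal:
  fixes R :: "real^'n::{finite,wellorder} \<Rightarrow> real^'n::{finite,wellorder}"
    and g :: "real^'n::{finite,wellorder} \<Rightarrow> real"
  assumes R: "orthogonal_transformation R" and g: "continuous_on (sphere 0 1) g"
  shows "(LINT x|sphere_measure. g (R x)) = (LINT x|sphere_measure. g x)"
  using integral_distr[OF distr_sphere_measure_orthogonal(1)[OF R] measurable_sphere_measureI[OF g]]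
  by (simp add: distr_sphere_measure_orthogonal(2)[OF R])

section \<open>Rotations in a coordinate plane\<close>

text \<open>
  For orthonormal \<open>u\<close>, \<open>v\<close> this is the rotation by the angle \<open>t\<close> in their plane and the identity on its
  orthogonal complement.
\<close>

definition plane_rotation :: "'a::real_inner \<Rightarrow> 'a \<Rightarrow> real \<Rightarrow> 'a \<Rightarrow> 'a"
  where "plane_rotation u v t x = x
    + ((cos t - 1) * (x \<bullet> u) - sin t * (x \<bullet> v)) *\<^sub>R u
    + ((cos t - 1) * (x \<bullet> v) + sin t * (x \<bullet> u)) *\<^sub>R v"

definition plane_generator :: "'a::real_inner \<Rightarrow> 'a \<Rightarrow> 'a \<Rightarrow> 'a"
  where "plane_generator u v x = (x \<bullet> u) *\<^sub>R v - (x \<bullet> v) *\<^sub>R u"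

lemma linear_plane_generator: "linear (plane_generator u v)"
  by (auto intro!: linearI simp: plane_generator_def inner_add_left algebra_simps)

lemma plane_rotation_0 [simp]: "plane_rotation u v 0 x = x"
  by (simp add: plane_rotation_def)

lemma orthogonal_plane_rotation:
  fixes u v :: "'a::euclidean_space"
  assumes "u \<bullet> u = 1" "v \<bullet> v = 1" "u \<bullet> v = 0"
  shows "orthogonal_transformation (plane_rotation u v t)"
  unfolding orthogonal_transformation
proof (intro conjI allI)
  show "linear (plane_rotation u v t)"
    by (auto intro!: linearI simp: plane_rotation_def inner_add_left algebra_simps)
  fix x
  have vu: "v \<bullet> u = 0" using assms(3) by (simp add: inner_commute)
  define a b c s where "a = x \<bullet> u" and "b = x \<bullet> v" and "c = cos t" and "s = sin t"
  have cs: "s * s = 1 - c * c" using sin_cos_squared_add3[of t] unfolding c_def s_def by linarith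
  define y z where "y = (c - 1) * a - s * b" and "z = (c - 1) * b + s * a"
  have "plane_rotation u v t x \<bullet> plane_rotation u v t x = (x + y *\<^sub>R u + z *\<^sub>R v) \<bullet> (x + y *\<^sub>R u + z *\<^sub>R v)"
    by (simp add: plane_rotation_def a_def b_def c_def s_def y_def z_def)
  also have "\<dots> = x \<bullet> x + (2 * y * a + 2 * z * b + y * y + z * z)"
    using assms vu by (simp add: inner_add_left inner_add_right inner_commute[of u x]
      inner_commute[of v x] a_def[symmetric] b_def[symmetric] algebra_simps)
  also have "2 * y * a + 2 * z * b + y * y + z * z =
      2 * (c - 1) * (a * a + b * b) + ((c - 1) * (c - 1) + s * s) * (a * a + b * b)"
    unfolding y_def z_def by (simp add: algebra_simps)
  finally have "plane_rotation u v t x \<bullet> plane_rotation u v t x = x \<bullet> x"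
    unfolding cs by (simp add: algebra_simps)
  then show "norm (plane_rotation u v t x) = norm x" by (simp add: norm_eq)
qed

text \<open>
  The rotations form the flow of the linear field \<^term>\<open>plane_generator u v\<close>.
\<close>

lemma has_derivative_plane_rotation:
  fixes u v :: "'a::euclidean_space"
  assumes "u \<bullet> u = 1" "v \<bullet> v = 1" "u \<bullet> v = 0"
  shows "((\<lambda>t. plane_rotation u v t x) has_derivative
    (\<lambda>h. h *\<^sub>R plane_generator u v (plane_rotation u v t x))) (at t)"
proof -
  have vu: "v \<bullet> u = 0" using assms(3) by (simp add: inner_commute)
  have "plane_generator u v (plane_rotation u v t x) =
      (cos t * (x \<bullet> u) - sin t * (x \<bullet> v)) *\<^sub>R v - (cos t * (x \<bullet> v) + sin t * (x \<bullet> u)) *\<^sub>R u"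
    using assms vu by (simp add: plane_generator_def plane_rotation_def inner_add_left algebra_simps)
  moreover have "((\<lambda>t. plane_rotation u v t x) has_derivative (\<lambda>h. h *\<^sub>R
      ((cos t * (x \<bullet> u) - sin t * (x \<bullet> v)) *\<^sub>R v - (cos t * (x \<bullet> v) + sin t * (x \<bullet> u)) *\<^sub>R u))) (at t)"
    unfolding plane_rotation_def
    by (auto intro!: derivative_eq_intros simp: algebra_simps)
  ultimately show ?thesis by simp
qed

text \<open>
  The integral of \<open>F\<^sup>2\<close> composed with the rotation by \<open>t\<close> does not depend on \<open>t\<close>. Its difference quotients
  at \<open>t = 0\<close> converge to the integral of \<open>2 F L F\<close> by dominated convergence: by the mean value theorem
  the integrand of a difference quotient is a value of \<open>2 F L F\<close> elsewhere on the sphere, hence bounded.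
\<close>

lemma integral_mult_plane_generator:
  fixes F :: "real^'n::{finite,wellorder} \<Rightarrow> real"
  assumes F: "smooth_on U F" and U: "open U" "sphere 0 1 \<subseteq> U"
    and uv: "u \<bullet> u = 1" "v \<bullet> v = 1" "u \<bullet> v = 0"
  shows "(LINT x|sphere_measure. F x * lin_deriv (plane_generator u v) F x) = 0"
proof -
  let ?R = "plane_rotation u v" and ?L = "lin_deriv (plane_generator u v) F"
  let ?M = "sphere_measure :: ((real,'n) vec) measure"
  interpret finite_measure ?M by (rule finite_measure_sphere_measure)
  have cF: "continuous_on (sphere 0 1) F"
    using continuous_on_subset[OF smooth_on_continuous[OF F] U(2)] .
  have cL: "continuous_on (sphere 0 1) ?L"
    using continuous_on_subset[OF smooth_on_continuous U(2)]
      smooth_on_lin_deriv[OF F U(1) linear_plane_generator] by blast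
  have cg: "continuous_on (sphere 0 1) (\<lambda>x. (F x)\<^sup>2)" by (intro continuous_intros cF)
  have cd: "continuous_on (sphere 0 1) (\<lambda>x. 2 * (F x * ?L x))" by (intro continuous_intros cF cL)
  obtain C where C: "\<And>x. x \<in> sphere 0 1 \<Longrightarrow> \<bar>2 * (F x * ?L x)\<bar> \<le> C"
    using continuous_sphere_bounded[OF cd] by blast
  have ort: "orthogonal_transformation (?R t)" for t by (rule orthogonal_plane_rotation[OF uv])
  have sph: "?R t x \<in> sphere 0 1" if "x \<in> sphere 0 1" for t x
    using that orthogonal_transformation_norm[OF ort] by simp
  have deriv: "((\<lambda>t. (F (?R t x))\<^sup>2) has_real_derivative 2 * (F (?R t x) * ?L (?R t x))) (at t)"
    if x: "x \<in> sphere 0 1" for x t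
  proof -
    have "?R t x \<in> U" using sph[OF x] U(2) by blast
    note D = smooth_on_has_derivative[OF F U(1) this]
    have "((\<lambda>t. F (?R t x)) has_derivative
        (\<lambda>h. dir_deriv (h *\<^sub>R plane_generator u v (?R t x)) F (?R t x))) (at t)"
      by (rule has_derivative_compose[OF has_derivative_plane_rotation[OF uv] D])
    then have "((\<lambda>t. F (?R t x)) has_derivative (\<lambda>h. h * ?L (?R t x))) (at t)"
      using linear_cmul[OF has_derivative_linear[OF D]] by (simp add: lin_deriv_def)
    then have "((\<lambda>t. F (?R t x)) has_real_derivative ?L (?R t x)) (at t)"
      by (rule has_derivative_imp_has_field_derivative) simp
    then show ?thesis by (auto intro!: derivative_eq_intros)
  qed
  define e where "e i = inverse (real (Suc i))" for i
  have e: "e i > 0" "e i \<noteq> 0" for i by (simp_all add: e_def)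
  define s where "s i x = ((F (?R (e i) x))\<^sup>2 - (F x)\<^sup>2) / e i" for i x
  have crot: "continuous_on (sphere 0 1) (\<lambda>x. (F (?R t x))\<^sup>2)" for t
  proof (rule continuous_on_compose2[OF cg])
    show "continuous_on (sphere 0 1) (?R t)"
      using ort[of t] by (intro linear_continuous_on)
        (simp add: orthogonal_transformation_def linear_conv_bounded_linear)
    show "?R t ` sphere 0 1 \<subseteq> sphere 0 1" using sph by blast
  qed
  have cs: "continuous_on (sphere 0 1) (s i)" for i
    unfolding s_def by (intro continuous_intros crot cg) (simp add: e)
  have bound: "\<bar>s i x\<bar> \<le> C" if x: "x \<in> sphere 0 1" for i x
  proof -
    obtain z where "(F (?R (e i) x))\<^sup>2 - (F (?R 0 x))\<^sup>2 = (e i - 0) * (2 * (F (?R z x) * ?L (?R z x)))"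
      using MVT2[OF e(1)[of i], of "\<lambda>t. (F (?R t x))\<^sup>2" "\<lambda>t. 2 * (F (?R t x) * ?L (?R t x))"]
        deriv[OF x] by blast
    then have "s i x = 2 * (F (?R z x) * ?L (?R z x))" using e[of i] by (simp add: s_def)
    then show ?thesis using C[OF sph[OF x]] by metis
  qed
  have lim: "(\<lambda>i. s i x) \<longlonglongrightarrow> 2 * (F x * ?L x)" if x: "x \<in> sphere 0 1" for x
  proof -
    have "((\<lambda>h. ((F (?R (0 + h) x))\<^sup>2 - (F (?R 0 x))\<^sup>2) / h) \<longlongrightarrow> 2 * (F (?R 0 x) * ?L (?R 0 x))) (at 0)"
      using deriv[OF x, of 0] unfolding DERIV_def .
    moreover have "filterlim e (at 0) sequentially"
      unfolding filterlim_at using LIMSEQ_inverse_real_of_nat e by (simp add: e_def[abs_def])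
    ultimately have "(\<lambda>i. ((F (?R (0 + e i) x))\<^sup>2 - (F (?R 0 x))\<^sup>2) / e i) \<longlonglongrightarrow> 2 * (F (?R 0 x) * ?L (?R 0 x))"
      by (rule filterlim_compose)
    then show ?thesis by (simp add: s_def)
  qed
  have "(\<lambda>i. LINT x|?M. s i x) \<longlonglongrightarrow> (LINT x|?M. 2 * (F x * ?L x))"
  proof (rule integral_dominated_convergence[where w = "\<lambda>_. C"])
    show "(\<lambda>x. 2 * (F x * ?L x)) \<in> borel_measurable ?M" by (rule measurable_sphere_measureI[OF cd])
    show "s i \<in> borel_measurable ?M" for i by (rule measurable_sphere_measureI[OF cs])
    show "AE x in ?M. (\<lambda>i. s i x) \<longlonglongrightarrow> 2 * (F x * ?L x)"
      by (rule AE_I2) (simp only: space_sphere_measure lim)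
    show "AE x in ?M. norm (s i x) \<le> C" for i
      by (rule AE_I2) (simp only: space_sphere_measure real_norm_def bound)
  qed simp
  moreover have "(LINT x|?M. s i x) = 0" for i
  proof -
    have "(LINT x|?M. s i x) = ((LINT x|?M. (F (?R (e i) x))\<^sup>2) - (LINT x|?M. (F x)\<^sup>2)) / e i"
      unfolding s_def
      using integrable_sphere_measureI[OF crot] integrable_sphere_measureI[OF cg] by simp
    then show ?thesis using integral_sphere_measure_orthogonal[OF ort cg] by simp
  qed
  ultimately have "(LINT x|?M. 2 * (F x * ?L x)) = 0" by (simp add: LIMSEQ_const_iff)
  then show ?thesis by simp
qed

text \<open>
  By skewness \<open>2 A\<close> is the sum of \<open>\<langle>A b, c\<rangle>\<close> times the generator of the rotations in the plane of \<open>b\<close>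
  and \<open>c\<close>, over all pairs of coordinate vectors.
\<close>

lemma integral_mult_lin_deriv:
  fixes F :: "real^'n::{finite,wellorder} \<Rightarrow> real"
  assumes F: "smooth_on U F" and U: "open U" "sphere 0 1 \<subseteq> U"
    and A: "linear A" and skew: "\<And>x y. A x \<bullet> y = - (A y \<bullet> x)"
  shows "(LINT x|sphere_measure. F x * lin_deriv A F x) = 0"
proof -
  let ?M = "sphere_measure :: ((real,'n) vec) measure"
  let ?L = "\<lambda>b c. lin_deriv (plane_generator b c) F"
  have A_eq: "2 *\<^sub>R A x = (\<Sum>b\<in>Basis. \<Sum>c\<in>Basis. (A b \<bullet> c) *\<^sub>R plane_generator b c x)" for x
  proof -
    have 1: "(\<Sum>b\<in>Basis. \<Sum>c\<in>Basis. ((x \<bullet> b) * (A b \<bullet> c)) *\<^sub>R c) = A x"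
    proof -
      have "A x = A (\<Sum>b\<in>Basis. (x \<bullet> b) *\<^sub>R b)" by (simp add: euclidean_representation)
      also have "\<dots> = (\<Sum>b\<in>Basis. (x \<bullet> b) *\<^sub>R A b)" by (simp only: linear_sum[OF A] linear_cmul[OF A])
      also have "\<dots> = (\<Sum>b\<in>Basis. (x \<bullet> b) *\<^sub>R (\<Sum>c\<in>Basis. (A b \<bullet> c) *\<^sub>R c))"
        by (simp only: euclidean_representation)
      finally show ?thesis by (simp add: scaleR_sum_right)
    qed
    have "(\<Sum>b\<in>Basis. \<Sum>c\<in>Basis. ((x \<bullet> c) * (A b \<bullet> c)) *\<^sub>R b) =
        (\<Sum>b\<in>Basis. \<Sum>c\<in>Basis. ((x \<bullet> b) * (A c \<bullet> b)) *\<^sub>R c)" by (rule sum.swap)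
    also have "\<dots> = (\<Sum>b\<in>Basis. \<Sum>c\<in>Basis. - (((x \<bullet> b) * (A b \<bullet> c)) *\<^sub>R c))"
    proof (intro sum.cong refl)
      fix b c show "((x \<bullet> b) * (A c \<bullet> b)) *\<^sub>R c = - (((x \<bullet> b) * (A b \<bullet> c)) *\<^sub>R c)"
        using skew[of c b] by simp
    qed
    also have "\<dots> = - A x" using 1 by (simp add: sum_negf)
    finally have 2: "(\<Sum>b\<in>Basis. \<Sum>c\<in>Basis. ((x \<bullet> c) * (A b \<bullet> c)) *\<^sub>R b) = - A x" .
    have "(\<Sum>b\<in>Basis. \<Sum>c\<in>Basis. (A b \<bullet> c) *\<^sub>R plane_generator b c x) =
       (\<Sum>b\<in>Basis. \<Sum>c\<in>Basis. ((x \<bullet> b) * (A b \<bullet> c)) *\<^sub>R c - ((x \<bullet> c) * (A b \<bullet> c)) *\<^sub>R b)"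
      by (simp add: plane_generator_def scaleR_right_diff_distrib mult.commute)
    then show ?thesis by (simp add: sum_subtractf 1 2 scaleR_2)
  qed
  have eq: "2 * (F x * lin_deriv A F x) = (\<Sum>b\<in>Basis. \<Sum>c\<in>Basis. (A b \<bullet> c) * (F x * ?L b c x))"
    if x: "x \<in> sphere 0 1" for x
  proof -
    have "x \<in> U" using x U(2) by blast
    note l = linear_dir_deriv[OF F U(1) this]
    have "2 * lin_deriv A F x = dir_deriv (2 *\<^sub>R A x) F x"
      by (simp add: lin_deriv_def linear_cmul[OF l])
    also have "\<dots> = (\<Sum>b\<in>Basis. \<Sum>c\<in>Basis. (A b \<bullet> c) * ?L b c x)"
      unfolding A_eq linear_sum[OF l] linear_cmul[OF l] lin_deriv_def by simp
    finally have "F x * (2 * lin_deriv A F x) = F x * (\<Sum>b\<in>Basis. \<Sum>c\<in>Basis. (A b \<bullet> c) * ?L b c x)"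
      by simp
    then show ?thesis by (simp add: sum_distrib_left algebra_simps)
  qed
  have cont: "continuous_on (sphere 0 1) (\<lambda>x. F x * ?L b c x)" for b c
    using continuous_on_subset[OF smooth_on_continuous U(2)] F
      smooth_on_lin_deriv[OF F U(1) linear_plane_generator] by (intro continuous_on_mult) blast+
  have int: "integrable ?M (\<lambda>x. (A b \<bullet> c) * (F x * ?L b c x))" for b c
    using integrable_sphere_measureI[OF cont] by simp
  have zero: "(LINT x|?M. (A b \<bullet> c) * (F x * ?L b c x)) = 0" if "b \<in> Basis" "c \<in> Basis" for b c
  proof (cases "b = c")
    case True
    then have "A b \<bullet> c = 0" using skew[of b b] by simp
    then show ?thesis by simp
  next
    case False
    then show ?thesis
      using integral_mult_plane_generator[OF F U, of b c] that by (simp add: inner_Basis)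
  qed
  have "(LINT x|?M. 2 * (F x * lin_deriv A F x)) =
      (LINT x|?M. (\<Sum>b\<in>Basis. \<Sum>c\<in>Basis. (A b \<bullet> c) * (F x * ?L b c x)))"
    by (rule Bochner_Integration.integral_cong[OF refl]) (rule eq, simp add: space_sphere_measure)
  also have "\<dots> = (\<Sum>b\<in>Basis. LINT x|?M. (\<Sum>c\<in>Basis. (A b \<bullet> c) * (F x * ?L b c x)))"
    by (rule Bochner_Integration.integral_sum) (intro Bochner_Integration.integrable_sum int)
  also have "\<dots> = (\<Sum>b\<in>Basis. \<Sum>c\<in>Basis. LINT x|?M. (A b \<bullet> c) * (F x * ?L b c x))"
    by (intro sum.cong refl Bochner_Integration.integral_sum int)
  also have "\<dots> = 0" by (simp only: zero sum.neutral_const cong: sum.cong)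
  finally show ?thesis by simp
qed

lemma square_integrable_cong:
  assumes "square_integrable M g" "\<And>x. x \<in> space M \<Longrightarrow> f x = g x"
  shows "square_integrable M f"
  using assms measurable_cong[of M f g borel] Bochner_Integration.integrable_cong[of M M "\<lambda>x. (f x)\<^sup>2" "\<lambda>x. (g x)\<^sup>2"]
  unfolding square_integrable_def by auto

lemma L2_orthogonal_cong:
  assumes "L2_orthogonal M f' g'" "\<And>x. x \<in> space M \<Longrightarrow> f x = f' x" "\<And>x. x \<in> space M \<Longrightarrow> g x = g' x"
  shows "L2_orthogonal M f g"
proof -
  have "(LINT x|M. f x * g x) = (LINT x|M. f' x * g' x)"
    by (rule Bochner_Integration.integral_cong) (simp_all add: assms)
  then show ?thesis
    using assms(1) square_integrable_cong[of M f' f] square_integrable_cong[of M g' g] assms(2,3)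
    by (simp add: L2_orthogonal_def)
qed

lemma L2_orthogonal_lin_deriv:
  fixes F :: "real^'n::{finite,wellorder} \<Rightarrow> real"
  assumes F: "smooth_on U F" and U: "open U" "sphere 0 1 \<subseteq> U"
    and A: "linear A" and skew: "\<And>x y. A x \<bullet> y = - (A y \<bullet> x)"
  shows "L2_orthogonal sphere_measure (lin_deriv A F) F"
proof -
  have "square_integrable (sphere_measure :: (real,'n) vec measure) G" if "smooth_on U G" for G
  proof -
    have "continuous_on (sphere 0 1) G"
      using continuous_on_subset[OF smooth_on_continuous[OF that] U(2)] .
    then show ?thesis unfolding square_integrable_def
      by (intro conjI measurable_sphere_measureI integrable_sphere_measureI continuous_intros)
  qed
  then show ?thesis
    using F smooth_on_lin_deriv[OF F U(1) A] integral_mult_lin_deriv[OF assms]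
    by (simp add: L2_orthogonal_def mult.commute)
qed

section \<open>The Killing field applied to an eigenfunction\<close>

lemma skew_if_inner_self_0:
  fixes A :: "'a::real_inner \<Rightarrow> 'a"
  assumes A: "linear A" and 0: "\<And>x. A x \<bullet> x = 0"
  shows "A x \<bullet> y = - (A y \<bullet> x)"
  using 0[of "x + y"] 0[of x] 0[of y] by (simp add: linear_add[OF A] inner_add_left inner_add_right)

theorem theorem1p1:
  fixes m n l \<alpha> \<beta> :: nat
    and \<Omega> :: "((real^('k::{finite,wellorder})) \<times> (real^'j::finite)) list \<Rightarrow> real"
    and W :: "nat \<Rightarrow> (real^('k::{finite,wellorder})) \<times> (real^'j)"
    and frame :: "real^('k::{finite,wellorder}) \<Rightarrow> (real^('k::{finite,wellorder})) list"
    and f :: "real^('k::{finite,wellorder}) \<Rightarrow> real"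
  assumes "m \<ge> 2" and "n \<ge> 3"
    and "CARD('k) = m + 1" and "CARD('j) = n - 1"
    and "alternating_form (m + 1) \<Omega>"
    and "orthonormal_basis_of {2..n} W (orthogonal_comp (range (\<lambda>x. (x, 0))))"
    and "\<And>p. p \<in> sphere 0 1 \<Longrightarrow> direct_frame p (frame p)"
    and "\<alpha> \<in> {2..n}" and "\<beta> \<in> {2..n}" and "\<alpha> < \<beta>"
    and "f \<in> sphere_eigenspace (sphere_eigenvalue m l)"
  shows "let h = (\<lambda>p. xi_form \<Omega> (W \<alpha>) (W \<beta>) (frame p) (sphere_grad f p))
         in h \<in> sphere_eigenspace (sphere_eigenvalue m l) \<and> L2_orthogonal sphere_measure h f"
proof -
  let ?h = "\<lambda>p. xi_form \<Omega> (W \<alpha>) (W \<beta>) (frame p) (sphere_grad f p)"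
  have "smooth_on_sphere f" using assms(11) unfolding sphere_eigenspace_def by blast
  then obtain U F where U: "open U" "sphere 0 1 \<subseteq> U" and F: "smooth_on U F"
    and eq: "\<forall>p\<in>sphere 0 1. F p = f p"
    unfolding smooth_on_sphere_def smooth_on_def by blast
  have "alternating_form CARD('k) \<Omega>" using assms(5) unfolding assms(3) .
  moreover have "CARD('k) \<ge> 2" using assms(1) unfolding assms(3) by linarith
  ultimately obtain A where A: "linear A" "\<And>x. A x \<bullet> x = 0"
    and xi: "\<And>p es X. norm p = 1 \<Longrightarrow> direct_frame p es \<Longrightarrow>
      xi_form \<Omega> (W \<alpha>) (W \<beta>) es X = A p \<bullet> X"
    using xi_form_skew[of \<Omega> "W \<alpha>" "W \<beta>"] by metis
  note skew = skew_if_inner_self_0[OF A]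
  have h: "lin_deriv A F p = ?h p" if p: "p \<in> sphere 0 1" for p
  proof -
    have "?h p = A p \<bullet> sphere_grad f p" using xi[OF _ assms(7)[OF p]] p by simp
    also have "\<dots> = dir_deriv (A p) F p"
      by (rule sphere_grad_inner_extension[OF F U eq p A(2)])
    finally show ?thesis by (simp add: lin_deriv_def)
  qed
  have "?h \<in> sphere_eigenspace (sphere_eigenvalue m l)"
    by (rule eigenspace_lin_deriv[OF F U eq assms(11) A(1) skew]) (use h in blast)
  moreover have "L2_orthogonal sphere_measure ?h f"
    by (rule L2_orthogonal_cong[OF L2_orthogonal_lin_deriv[OF F U A(1) skew]])
       (use h eq in \<open>simp_all add: space_sphere_measure\<close>)
  ultimately show ?thesis unfolding Let_def by blast
qed

end
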